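(* There exist universal constants $v_0, \eta_0, c_0 > 0$ such that for every $n \geq 1$, every convex body $K \subseteq \mathbb{R}^n$ with $\|b(K)\|_2 = \eta \leq \eta_0$ and $\gamma_n(K) = \alpha \geq 3/5$, every $v \in [-v_0,v_0]$ and every unit vector $\theta \in \mathbb{R}^n$, we have \[ \gamma_{n-1}(K_v^\theta) \geq (\alpha - c_0\eta)\Big(1 - \frac{e^{-\frac{1}{100 v^2}}}{4\sqrt{2\pi}}\Big). \]
   Context: $\gamma_k(A) = (2\pi)^{-k/2}\int_A e^{-\|x\|_2^2/2}dx$; $\gamma_0(A)=1$ if $0\in A$ and $0$ otherwise. For a unit vector $\theta$ and $v \in \mathbb{R}$, $K_v^\theta = (K - v\theta)\cap\{x : \langle\theta,x\rangle = 0\}$, and $\gamma_{n-1}(K_v^\theta)$ is its Gaussian measure within the hyperplane $\theta^\perp$. $b(K) = \frac{1}{\gamma_n(K)}(2\pi)^{-n/2}\int_K xe^{-\|x\|_2^2/2}dx$. A convex body is a closed convex set with non-empty interior. For $v=0$, $e^{-1/(100v^2)}$ is read as $0$. *)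

theory Defs
  imports "HOL-Analysis.Analysis"
begin

text \<open>
  The constants of the theorem are independent of the dimension, so the dimension has to be a
  bound natural number and cannot be a type. The space of dimension \<open>n\<close> consists of the real
  functions on \<open>{..<n}\<close> that are \<open>undefined\<close> elsewhere. This is the carrier of both the
  \<open>n\<close>-fold product topology and the \<open>n\<close>-fold product of \<^const>\<open>lborel\<close>; the Euclidean norm
  of \<open>x\<close> is \<open>L2_set x {..<n}\<close>.
\<close>

definition Rn :: "nat \<Rightarrow> (nat \<Rightarrow> real) set" where
  "Rn n = {..<n} \<rightarrow>\<^sub>E UNIV"

definition Rn_topology :: "nat \<Rightarrow> (nat \<Rightarrow> real) topology" where
  "Rn_topology n = product_topology (\<lambda>_. euclideanreal) {..<n}"

definition Rn_lebesgue :: "nat \<Rightarrow> (nat \<Rightarrow> real) measure" where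
  "Rn_lebesgue n = (\<Pi>\<^sub>M i\<in>{..<n}. lborel)"

lemma topspace_Rn_topology: "topspace (Rn_topology n) = Rn n"
  by (simp add: Rn_topology_def Rn_def)

lemma space_Rn_lebesgue: "space (Rn_lebesgue n) = Rn n"
  by (simp add: Rn_lebesgue_def Rn_def space_PiM)

definition dot :: "nat \<Rightarrow> (nat \<Rightarrow> real) \<Rightarrow> (nat \<Rightarrow> real) \<Rightarrow> real" where
  "dot n x y = (\<Sum>i<n. x i * y i)"

definition convex_body :: "nat \<Rightarrow> (nat \<Rightarrow> real) set \<Rightarrow> bool" where
  "convex_body n K \<longleftrightarrow>
     closedin (Rn_topology n) K \<and>
     (\<forall>x\<in>K. \<forall>y\<in>K. \<forall>t\<in>{0..1}. (\<lambda>i\<in>{..<n}. (1 - t) * x i + t * y i) \<in> K) \<and>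
     Rn_topology n interior_of K \<noteq> {}"

text \<open>
  For \<open>n = 0\<close> the measure \<^term>\<open>Rn_lebesgue 0\<close> is the unit mass at the only point of the space,
  so \<^term>\<open>gauss 0 A\<close> is \<open>1\<close> or \<open>0\<close> according to whether \<open>A\<close> contains that point.
\<close>

definition gauss :: "nat \<Rightarrow> (nat \<Rightarrow> real) set \<Rightarrow> real" where
  "gauss n A = (2 * pi) powr (- real n / 2) *
     (LINT x:A|Rn_lebesgue n. exp (- (L2_set x {..<n})\<^sup>2 / 2))"

definition barycenter :: "nat \<Rightarrow> (nat \<Rightarrow> real) set \<Rightarrow> nat \<Rightarrow> real" where
  "barycenter n K = (\<lambda>i\<in>{..<n}. 1 / gauss n K * ((2 * pi) powr (- real n / 2) *
     (LINT x:K|Rn_lebesgue n. x i * exp (- (L2_set x {..<n})\<^sup>2 / 2))))"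

definition hyperplane_section ::
    "nat \<Rightarrow> (nat \<Rightarrow> real) set \<Rightarrow> (nat \<Rightarrow> real) \<Rightarrow> real \<Rightarrow> (nat \<Rightarrow> real) set" where
  "hyperplane_section n K \<theta> v =
     (\<lambda>x. \<lambda>i\<in>{..<n}. x i - v * \<theta> i) ` K \<inter> {x \<in> Rn n. dot n \<theta> x = 0}"

text \<open>
  The Gaussian measure within the hyperplane orthogonal to \<open>\<theta>\<close> is obtained by identifying
  this hyperplane with the space of dimension \<open>n - 1\<close> through an orthonormal basis
  \<open>u 0, \<dots>, u (n - 2)\<close>. Being \<open>n - 1\<close> orthonormal vectors of the hyperplane, the \<open>u j\<close> span it.
\<close>

definition hyperplane_basis :: "nat \<Rightarrow> (nat \<Rightarrow> real) \<Rightarrow> (nat \<Rightarrow> nat \<Rightarrow> real) \<Rightarrow> bool" where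
  "hyperplane_basis n \<theta> u \<longleftrightarrow>
     (\<forall>j<n-1. u j \<in> Rn n \<and> dot n \<theta> (u j) = 0) \<and>
     (\<forall>j<n-1. \<forall>k<n-1. dot n (u j) (u k) = (if j = k then 1 else 0))"

definition hyperplane_gauss ::
    "nat \<Rightarrow> (nat \<Rightarrow> nat \<Rightarrow> real) \<Rightarrow> (nat \<Rightarrow> real) set \<Rightarrow> real" where
  "hyperplane_gauss n u A =
     gauss (n - 1) {y \<in> Rn (n - 1). (\<lambda>i\<in>{..<n}. \<Sum>j<n-1. y j * u j i) \<in> A}"

lemma gauss_0: "gauss 0 A = (if (\<lambda>_. undefined) \<in> A then 1 else 0)"
proof -
  let ?c = "if (\<lambda>_. undefined) \<in> A then 1 else 0 :: real"
  let ?M = "Rn_lebesgue 0"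
  have "(LINT x:A|?M. exp (- (L2_set x {..<0})\<^sup>2 / 2)) = (LINT x|?M. ?c)"
    unfolding set_lebesgue_integral_def
    by (intro Bochner_Integration.integral_cong)
       (auto simp: Rn_lebesgue_def space_PiM_empty indicator_def)
  also have "\<dots> = ?c"
    by (simp add: Rn_lebesgue_def measure_def space_PiM_empty)
  finally show ?thesis by (simp add: gauss_def)
qed

text \<open>
  The basis comes from the reflection that exchanges the last unit vector and \<open>\<theta>\<close> up to sign.
\<close>

lemma hyperplane_basis_exists:
  assumes n: "n \<ge> 1" and \<theta>: "L2_set \<theta> {..<n} = 1"
  shows "\<exists>u. hyperplane_basis n \<theta> u"
proof -
  obtain m where m: "n = Suc m" using n by (cases n) auto
  define s :: real where "s = (if \<theta> m \<ge> 0 then 1 else -1)"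
  define f where "f i = s * \<theta> i" for i
  define a where "a = f m"
  have a: "1 + a > 0" by (auto simp: a_def f_def s_def)
  have "(\<Sum>i<n. (\<theta> i)\<^sup>2) = 1" using \<theta> by (simp add: L2_set_def)
  then have "(\<Sum>i<n. f i * f i) = 1"
    by (simp add: f_def s_def power2_eq_square split: if_splits)
  then have F: "(\<Sum>i<m. f i * f i) = 1 - a * a" by (simp add: m a_def)
  define c where "c j = f j / (1 + a)" for j
  have cf: "f j = c j * (1 + a)" for j using a by (simp add: c_def)
  define u where "u j = (\<lambda>i\<in>{..<n}. (if i = j then 1 else 0)
      - c j * (f i + (if i = m then 1 else 0)))" for j
  have orth: "dot n f (u j) = 0" if "j < m" for j
  proof -
    have "dot n f (u j) = (\<Sum>i<m. (if i = j then f i else 0) - c j * (f i * f i)) - a * (c j * (a + 1))"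
    proof -
      have "dot n f (u j) = (\<Sum>i<m. f i * ((if i = j then 1 else 0) - c j * f i))
          - a * (c j * (a + 1))"
        using that by (simp add: dot_def u_def m a_def)
      also have "(\<Sum>i<m. f i * ((if i = j then 1 else 0) - c j * f i)) =
          (\<Sum>i<m. (if i = j then f i else 0) - c j * (f i * f i))"
        by (intro sum.cong) (auto simp: algebra_simps)
      finally show ?thesis .
    qed
    also have "\<dots> = f j - c j * (1 - a * a) - a * (c j * (a + 1))"
      using that by (simp add: sum_subtractf F sum_distrib_left[symmetric])
    also have "\<dots> = 0" by (simp add: cf[of j] algebra_simps)
    finally show ?thesis .
  qed
  have on: "dot n (u j) (u k) = (if j = k then 1 else 0)" if "j < m" "k < m" for j k
  proof -
    have "dot n (u j) (u k) = (\<Sum>i<m. ((if i = j then 1 else 0) - c j * f i)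
        * ((if i = k then 1 else 0) - c k * f i)) + c j * (a + 1) * (c k * (a + 1))"
      using that by (simp add: dot_def u_def m a_def)
    also have "(\<Sum>i<m. ((if i = j then 1 else 0) - c j * f i)
        * ((if i = k then 1 else 0) - c k * f i)) =
        (\<Sum>i<m. (if i = j then if j = k then 1 else 0 else 0) - (if i = j then c k * f i else 0)
          - (if i = k then c j * f i else 0) + c j * c k * (f i * f i))"
      by (intro sum.cong) (auto simp: algebra_simps)
    also have "\<dots> = (if j = k then 1 else 0) - c k * f j - c j * f k + c j * c k * (1 - a * a)"
      using that by (simp add: sum_subtractf sum.distrib F sum_distrib_left[symmetric])
    also have "\<dots> + c j * (a + 1) * (c k * (a + 1)) = (if j = k then 1 else 0)"
      by (simp add: cf[of j] cf[of k] algebra_simps)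
    finally show ?thesis .
  qed
  have "dot n f x = s * dot n \<theta> x" for x
    by (simp add: dot_def f_def sum_distrib_left mult.assoc)
  then have "dot n \<theta> (u j) = 0" if "j < m" for j
    using orth[OF that] by (simp add: s_def split: if_splits)
  then have "hyperplane_basis n \<theta> u"
    using on by (auto simp: hyperplane_basis_def m Rn_def u_def)
  then show ?thesis by blast
qed

end

theory Submission
  imports Defs "HOL-Probability.Probability"
begin

text \<open>
  Let \<open>f v\<close> be the Gaussian measure of the section at height \<open>v\<close>. By rotation invariance \<open>f\<close> is a
  marginal of a log-concave function, hence log-concave (Prekopa), with values in \<open>[0, 1]\<close>,
  Gaussian mean \<open>\<alpha>\<close>, and first moment \<open>\<alpha> m\<close> with \<open>\<bar>m\<bar> \<le> \<eta>\<close>. All the rest is one-dimensional.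

  Let \<open>f x \<le> f v * exp (- s (x - v))\<close> be a supporting line of \<open>ln f\<close> at \<open>v\<close>; after a reflection
  \<open>s \<ge> 0\<close>. Integrating \<open>f x * exp (s (x - v)) \<le> f v\<close> gives \<open>f v \<ge> \<alpha> (1 - s (v - m))\<close>, with an additional
  gain of order \<open>s\<^sup>2\<close>, so only small slopes are dangerous. For those, the decay of \<open>f\<close> to the right
  of \<open>v\<close> lowers the first moment by about \<open>\<alpha> s / 2\<close>, and \<open>f\<close> must have an equally large deficit
  below \<open>\<alpha>\<close> on the left. But the total mass of this deficit is at most \<open>\<alpha> s (v - m)\<close>, which
  pushes it out to distance of order \<open>1 / v\<close>. There the Gaussian measure is exponentially
  small in \<open>1 / v\<^sup>2\<close>, and so is \<open>s\<close>.
\<close>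

section \<open>The one-dimensional Gaussian measure\<close>

text \<open>A first-order loss \<open>s * (v - m)\<close> of at most \<eta> is absorbed by the term
  c_0 \<eta> with c_0 = 1. If s < 1/20 and the loss is larger, then v and s both exceed fixed
  multiples of \<eta>, so m is negligible against either of them. What remains is a balance at a cut
  r. The deficit within distance r on the left contributes at most (r + v) s (v - m) to the first
  moment (relative to \<alpha>), which stays below the required s / 2 only if r v is a small
  constant; the part beyond r contributes at most twice the normal density at r. Hence s is at most
  a multiple of exp (- r^2 / 2). The choice r v = 19/100 meets the balance and still gives r^2 / 2
  >= 1 / (100 v^2). Points are coordinate functions because the dimension is a number. Therefore
  Prekopa's theorem is obtained by integrating out one coordinate at a time, each time by the
  one-dimensional Prekopa-Leindler inequality, and rotation invariance is derived from translation
  invariance of the product measure and from the radial form of the Gaussian density.\<close>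

definition std_normal :: "real measure" where
  "std_normal = density lborel (\<lambda>x. ennreal (std_normal_density x))"

lemma sets_std_normal [simp, measurable_cong]: "sets std_normal = sets borel"
  and space_std_normal [simp]: "space std_normal = UNIV"
  by (simp_all add: std_normal_def)

interpretation std_normal: prob_space std_normal
  unfolding std_normal_def by (rule prob_space_normal_density) simp

lemma integrable_std_normal_iff:
  fixes h :: "real \<Rightarrow> real"
  assumes [measurable]: "h \<in> borel_measurable borel"
  shows "integrable std_normal h \<longleftrightarrow> integrable lborel (\<lambda>x. std_normal_density x * h x)"
  unfolding std_normal_def by (subst integrable_density) auto

lemma integral_std_normal:
  fixes h :: "real \<Rightarrow> real"
  assumes [measurable]: "h \<in> borel_measurable borel"
  shows "(\<integral>x. h x \<partial>std_normal) = (\<integral>x. std_normal_density x * h x \<partial>lborel)"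
  unfolding std_normal_def by (subst integral_density) auto

lemma integral_std_normal_uminus:
  fixes h :: "real \<Rightarrow> real"
  assumes [measurable]: "h \<in> borel_measurable borel"
  shows "(\<integral>x. h (- x) \<partial>std_normal) = (\<integral>x. h x \<partial>std_normal)"
proof -
  have "(\<integral>x. std_normal_density x * h x \<partial>lborel)
      = (\<integral>x. std_normal_density x * h (- x) \<partial>lborel)"
    using lborel_integral_real_affine[of "-1" "\<lambda>x. std_normal_density x * h x" 0]
    by (simp add: std_normal_density_def)
  then show ?thesis by (simp add: integral_std_normal)
qed

lemma integrable_std_normal_power [simp]: "integrable std_normal (\<lambda>x. x ^ k)"
  and integrable_std_normal_abs_power [simp]: "integrable std_normal (\<lambda>x. \<bar>x\<bar> ^ k)"
  using integrable_std_normal_moment[of k] integrable_std_normal_moment_abs[of k]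
  by (simp_all add: integrable_std_normal_iff)

lemma integrable_std_normal_id [simp]: "integrable std_normal (\<lambda>x. x)"
  and integrable_std_normal_abs [simp]: "integrable std_normal (\<lambda>x. \<bar>x\<bar>)"
  using integrable_std_normal_power[of 1] integrable_std_normal_abs_power[of 1] by simp_all

lemma std_normal_moments:
  "(\<integral>x. x \<partial>std_normal) = 0" "(\<integral>x. x\<^sup>2 \<partial>std_normal) = 1" "(\<integral>x. x ^ 3 \<partial>std_normal) = 0"
  "(\<integral>x. \<bar>x\<bar> \<partial>std_normal) = sqrt (2 / pi)" "(\<integral>x. \<bar>x\<bar> ^ 3 \<partial>std_normal) = 2 * sqrt (2 / pi)"
  using integral_std_normal_moment_odd[of 0] integral_std_normal_moment_odd[of 1]
    integral_std_normal_moment_even[of 1]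
    integral_std_normal_moment_abs_odd[of 0] integral_std_normal_moment_abs_odd[of 1]
  by (simp_all add: integral_std_normal fact_numeral del: integral_std_normal_moment_odd)

lemma std_normal_integrable_bounded:
  fixes h :: "real \<Rightarrow> real"
  assumes "h \<in> borel_measurable borel" "\<And>x. \<bar>h x\<bar> \<le> B"
  shows "integrable std_normal h"
  by (rule std_normal.integrable_const_bound[where B=B]) (use assms in auto)

lemma std_normal_integrable_mult_bounded:
  fixes g h :: "real \<Rightarrow> real"
  assumes [measurable]: "h \<in> borel_measurable borel" and h: "\<And>x. \<bar>h x\<bar> \<le> B"
    and g: "integrable std_normal g"
  shows "integrable std_normal (\<lambda>x. g x * h x)"
proof (rule Bochner_Integration.integrable_bound)
  show "integrable std_normal (\<lambda>x. B * g x)" using g by simp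
  show "(\<lambda>x. g x * h x) \<in> borel_measurable std_normal"
    using borel_measurable_integrable[OF g] by simp
  have "\<bar>h x\<bar> \<le> \<bar>B\<bar>" for x using h[of x] by simp
  then show "AE x in std_normal. norm (g x * h x) \<le> norm (B * g x)"
    by (intro always_eventually allI) (simp add: abs_mult mult.commute[of "\<bar>g _\<bar>"] mult_right_mono)
qed

lemma sqrt_2pi_ge_2: "2 \<le> sqrt (2 * pi)"
  by (rule real_le_rsqrt) (use pi_gt3 in \<open>simp add: power2_eq_square\<close>)

lemma sqrt_2_div_pi_le_1: "sqrt (2 / pi) \<le> 1"
  using pi_gt3 by simp

lemma std_normal_density_le_half: "std_normal_density x \<le> 1 / 2"
proof -
  have "std_normal_density x \<le> 1 / sqrt (2 * pi)"
    unfolding std_normal_density_def by (intro mult_left_le) auto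
  also have "\<dots> \<le> 1 / 2"
    using sqrt_2pi_ge_2 by (intro divide_left_mono) auto
  finally show ?thesis .
qed

text \<open>A density of at most 1/2 on an interval of length 2 a.\<close>

lemma std_normal_interval_le:
  assumes "0 \<le> a"
  shows "measure std_normal {x. \<bar>x - v\<bar> < a} \<le> a"
proof -
  have "{x. \<bar>x - v\<bar> < a} = {v - a<..<v + a}" by auto
  then have "emeasure std_normal {x. \<bar>x - v\<bar> < a}
      = (\<integral>\<^sup>+x. ennreal (std_normal_density x) * indicator {v - a<..<v + a} x \<partial>lborel)"
    unfolding std_normal_def by (subst emeasure_density) auto
  also have "\<dots> \<le> (\<integral>\<^sup>+x. ennreal (1 / 2) * indicator {v - a<..<v + a} x \<partial>lborel)"
    by (intro nn_integral_mono mult_right_mono ennreal_leI std_normal_density_le_half) auto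
  also have "\<dots> = ennreal a"
    using assms by (simp add: nn_integral_cmult_indicator ennreal_mult'[symmetric] del: ennreal_half)
  finally show ?thesis
    using assms by (simp add: measure_def enn2real_leI)
qed

text \<open>The density has derivative \<open>- x * std_normal_density x\<close>. The reflection
  moves the tail to the right half-line, where the integrand is nonnegative.\<close>

lemma std_normal_tail_moment:
  "integrable std_normal (\<lambda>x. - x * indicator {x. x < - r} x)"
  "(\<integral>x. - x * indicator {x. x < - r} x \<partial>std_normal) = std_normal_density r" if "0 \<le> r"
proof -
  show int: "integrable std_normal (\<lambda>x. - x * indicator {x. x < - r} x)" for r
    by (intro std_normal_integrable_mult_bounded[where B=1]) (auto simp: indicator_def)
  have lim: "((\<lambda>x. - std_normal_density x) \<longlongrightarrow> 0) at_top"
    unfolding std_normal_density_def by real_asymp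
  have "(\<integral>x. - x * indicator {x. x < - r} x \<partial>std_normal)
      = (\<integral>x. - (- x) * indicator {x. x < - r} (- x) \<partial>std_normal)"
    by (rule integral_std_normal_uminus[symmetric]) auto
  also have "\<dots> = (\<integral>x. x * indicator {r<..} x \<partial>std_normal)"
    by (intro Bochner_Integration.integral_cong) (auto simp: indicator_def)
  also have "\<dots> = (\<integral>x. std_normal_density x * (x * indicator {r<..} x) \<partial>lborel)"
    by (rule integral_std_normal) auto
  also have "\<dots> = enn2real (\<integral>\<^sup>+x. std_normal_density x * (x * indicator {r<..} x) \<partial>lborel)"
    using that by (intro integral_eq_nn_integral) (auto simp: indicator_def)
  also have "(\<integral>\<^sup>+x. std_normal_density x * (x * indicator {r<..} x) \<partial>lborel)
      = (\<integral>\<^sup>+x. ennreal (std_normal_density x * x) * indicator {r..} x \<partial>lborel)"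
    by (intro nn_integral_cong_AE, use AE_lborel_singleton[of r] in eventually_elim)
       (auto simp: indicator_def)
  also have "\<dots> = ennreal (0 - - std_normal_density r)"
  proof (rule nn_integral_FTC_atLeast)
    fix x assume "r \<le> x"
    show "DERIV (\<lambda>x. - std_normal_density x) x :> std_normal_density x * x"
    proof -
      have "DERIV (\<lambda>x. - (c * exp (- x\<^sup>2 / 2))) x :> c * exp (- x\<^sup>2 / 2) * x" for c :: real
        by (auto intro!: derivative_eq_intros)
      then show ?thesis unfolding std_normal_density_def .
    qed
    show "0 \<le> std_normal_density x * x" using \<open>r \<le> x\<close> that by simp
  qed (use lim in auto)
  finally show "(\<integral>x. - x * indicator {x. x < - r} x \<partial>std_normal) = std_normal_density r" by simp
qed

section \<open>Log-concave weights on the line\<close>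

text \<open>The multiplicative form admits zeros of f: \<open>powr\<close> of 0 is 0, so nothing is
  claimed when f vanishes at x or y. Concavity of \<open>ln\<close> would need the value minus
  infinity there.\<close>

definition log_concave :: "(real \<Rightarrow> real) \<Rightarrow> bool" where
  "log_concave f \<longleftrightarrow> (\<forall>x. 0 \<le> f x) \<and>
     (\<forall>x y t. 0 < t \<longrightarrow> t < 1 \<longrightarrow> f x powr (1 - t) * f y powr t \<le> f ((1 - t) * x + t * y))"

lemma log_concave_nonneg: "log_concave f \<Longrightarrow> 0 \<le> f x"
  by (simp add: log_concave_def)

lemma log_concaveD:
  "log_concave f \<Longrightarrow> 0 < t \<Longrightarrow> t < 1 \<Longrightarrow> f x powr (1 - t) * f y powr t \<le> f ((1 - t) * x + t * y)"
  by (simp add: log_concave_def)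

lemma log_concave_superlevel_convex:
  assumes f: "log_concave f" and "0 \<le> s"
  shows "convex {x. s < f x}"
proof (rule convexI)
  fix x y u v :: real
  assume *: "x \<in> {x. s < f x}" "y \<in> {x. s < f x}" "0 \<le> u" "0 \<le> v" "u + v = 1"
  show "u *\<^sub>R x + v *\<^sub>R y \<in> {x. s < f x}"
  proof (cases "0 < v \<and> v < 1")
    case True
    have u: "u = 1 - v" using * by simp
    have "s = s powr (1 - v) * s powr v" using \<open>0 \<le> s\<close> by (simp add: powr_add[symmetric])
    also have "\<dots> < f x powr (1 - v) * f y powr v"
      using * \<open>0 \<le> s\<close> True by (intro mult_strict_mono powr_less_mono2) auto
    also have "\<dots> \<le> f ((1 - v) * x + v * y)" using log_concaveD[OF f] True by blast
    finally show ?thesis by (simp add: u)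
  next
    case False
    then have "v = 0 \<and> u = 1 \<or> v = 1 \<and> u = 0" using * by auto
    with * show ?thesis by auto
  qed
qed

text \<open>Positive values on both sides put v into the interior of the support, where
  \<open>- ln f\<close> is convex and has a subgradient. Off the support f is 0 and the bound is
  trivial.\<close>

lemma log_concave_support_line:
  assumes f: "log_concave f" and "a < v" "v < b" "0 < f a" "0 < f b"
  shows "0 < f v \<and> (\<exists>k. \<forall>x. f x \<le> f v * exp (k * (x - v)))"
proof -
  let ?I = "{x. 0 < f x}"
  have I: "convex ?I" by (rule log_concave_superlevel_convex[OF f]) simp
  then have "is_interval ?I" by (simp add: is_interval_convex_1)
  then have "{a<..<b} \<subseteq> ?I"
    using mem_is_interval_1_I[of ?I a b] assms(4,5) by auto
  then have int: "v \<in> interior ?I"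
    using assms(2,3) by (intro interiorI[of "{a<..<b}"]) auto
  then have v: "0 < f v" using interior_subset by blast
  have conv: "convex_on ?I (\<lambda>x. - ln (f x))"
  proof (rule convex_onI)
    fix t x y :: real
    assume t: "0 < t" "t < 1" and x: "x \<in> ?I" and y: "y \<in> ?I"
    have "0 < f x powr (1 - t) * f y powr t" using x y by simp
    then have "ln (f x powr (1 - t) * f y powr t) \<le> ln (f ((1 - t) * x + t * y))"
      using log_concaveD[OF f t, of x y] by (subst ln_le_cancel_iff) auto
    then have "(1 - t) * ln (f x) + t * ln (f y) \<le> ln (f ((1 - t) * x + t * y))"
      using x y by (simp add: ln_mult ln_powr)
    then show "- ln (f ((1 - t) *\<^sub>R x + t *\<^sub>R y)) \<le> (1 - t) * - ln (f x) + t * - ln (f y)"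
      by simp
  qed (rule I)
  obtain k where k: "\<And>x. x \<in> ?I \<Longrightarrow> - ln (f x) \<ge> - ln (f v) + k * (x - v)"
    using convex_le_Inf_differential[OF conv int] by blast
  have "f x \<le> f v * exp (- k * (x - v))" for x
  proof (cases "0 < f x")
    case True
    then have "ln (f x) \<le> ln (f v) + - k * (x - v)" using k[of x] by simp
    then have "exp (ln (f x)) \<le> exp (ln (f v)) * exp (- k * (x - v))"
      unfolding exp_add[symmetric] by simp
    then show ?thesis using True v by simp
  next
    case False
    then show ?thesis using v by (smt (verit) exp_gt_zero mult_pos_pos)
  qed
  then show ?thesis using v by blast
qed

lemma integrable_positive_part_sq: "integrable std_normal (\<lambda>x. (max 0 (x - v))\<^sup>2)"
proof (rule Bochner_Integration.integrable_bound)
  show "integrable std_normal (\<lambda>x. x\<^sup>2 - 2 * v * x + v\<^sup>2)" by simp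
  show "AE x in std_normal. norm ((max 0 (x - v))\<^sup>2) \<le> norm (x\<^sup>2 - 2 * v * x + v\<^sup>2)"
  proof (intro always_eventually allI)
    fix x :: real
    have "x\<^sup>2 - 2 * v * x + v\<^sup>2 = (x - v)\<^sup>2" by (simp add: power2_eq_square algebra_simps)
    then show "norm ((max 0 (x - v))\<^sup>2) \<le> norm (x\<^sup>2 - 2 * v * x + v\<^sup>2)"
      by (auto simp: max_def)
  qed
qed simp

text \<open>The product of 1 - y + y^2 / 2 and 1 + y + y^2 / 2 is 1 + y^4 / 4, and the second factor
  is at most exp y.\<close>

lemma exp_minus_le_quadratic:
  assumes "0 \<le> (y::real)" shows "exp (- y) \<le> 1 - y + y\<^sup>2 / 2"
proof -
  have pos: "0 < 1 - y + y\<^sup>2 / 2"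
  proof -
    have "0 \<le> (y - 1)\<^sup>2" by simp
    then show ?thesis by (simp add: power2_eq_square algebra_simps)
  qed
  have "1 \<le> (1 - y + y\<^sup>2 / 2) * (1 + y + y\<^sup>2 / 2)"
  proof -
    have "(1 - y + y\<^sup>2 / 2) * (1 + y + y\<^sup>2 / 2) = 1 + (y\<^sup>2 / 2)\<^sup>2"
      by (simp add: power2_eq_square algebra_simps)
    then show ?thesis by simp
  qed
  also have "\<dots> \<le> (1 - y + y\<^sup>2 / 2) * exp y"
    using exp_lower_Taylor_quadratic[OF assms] pos by (intro mult_left_mono) auto
  finally show ?thesis by (simp add: exp_minus field_simps)
qed

text \<open>In the application f gives the Gaussian measures of the sections and m is the inner
  product of the barycenter with \<theta>. Log-concavity enters through the tangent inequality that
  the lemmas below take as a premise.\<close>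

locale gaussian_weight =
  fixes f :: "real \<Rightarrow> real" and \<alpha> m :: real
  assumes meas [measurable]: "f \<in> borel_measurable borel"
    and f0: "\<And>x. 0 \<le> f x" and f1: "\<And>x. f x \<le> 1"
    and mass: "(\<integral>x. f x \<partial>std_normal) = \<alpha>" and \<alpha>: "3 / 5 \<le> \<alpha>"
    and mean: "(\<integral>x. x * f x \<partial>std_normal) = \<alpha> * m"
begin

lemma integrable_weight: "integrable std_normal f"
  by (rule std_normal_integrable_bounded[where B=1]) (use f0 f1 in auto)

lemma integrable_mult_weight: "integrable std_normal g \<Longrightarrow> integrable std_normal (\<lambda>x. g x * f x)"
  by (rule std_normal_integrable_mult_bounded[where B=1]) (use f0 f1 in auto)

lemma integrable_id_weight: "integrable std_normal (\<lambda>x. x * f x)"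
  by (rule integrable_mult_weight) simp

text \<open>
  The density of \<open>f\<close> is at most \<open>5 / 3\<close> times the Gaussian one, hence it cannot concentrate
  near \<open>v\<close>, and as its mean is not much smaller than \<open>v\<close>, some of it lies to the right of \<open>v\<close>.
\<close>

lemma positive_part_second_moment:
  assumes "v - m \<le> 1 / 1000"
  shows "\<alpha> / 200 \<le> (\<integral>x. (max 0 (x - v))\<^sup>2 * f x \<partial>std_normal)"
proof -
  let ?J = "{x. \<bar>x - v\<bar> < 1 / 4}"
  have int: "integrable std_normal (\<lambda>x. indicator ?J x :: real)"
    by (rule std_normal_integrable_bounded[where B=1]) (auto simp: indicator_def)
  \<comment> \<open>With z = x - v, the affine function z / 8 + 1 / 32 is at most 0 for z \<le> -
    1/4, at most z^2 for z \<ge> 1/4, and at most 1/16 in between. Cutting out the window thus costs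
    at most 1/16 * 1/4 = 1/64, which is at most 5 \<alpha> / 192 since \<alpha> \<ge> 3/5; and
    \<alpha>/32 - 5 \<alpha>/192 - \<alpha>/8000 still exceeds \<alpha>/200.\<close>
  have "\<alpha> / 200 \<le> 1 / 8 * (\<alpha> * m) + (1 / 32 - v / 8) * \<alpha> - 1 / 16 * (1 / 4)"
  proof -
    have "1 / 64 \<le> 5 / 192 * \<alpha>" using \<alpha> by simp
    moreover have "\<alpha> * (v - m) \<le> \<alpha> * (1 / 1000)" using assms \<alpha> by (intro mult_left_mono) auto
    ultimately show ?thesis using \<alpha> by (simp add: algebra_simps)
  qed
  also have "\<dots> \<le> 1 / 8 * (\<alpha> * m) + (1 / 32 - v / 8) * \<alpha> - 1 / 16 * measure std_normal ?J"
    using std_normal_interval_le[of "1 / 4" v] by simp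
  also have "\<dots> = (\<integral>x. 1 / 8 * (x * f x) + (1 / 32 - v / 8) * f x - 1 / 16 * indicator ?J x \<partial>std_normal)"
    using int integrable_weight integrable_id_weight by (simp add: mass mean)
  also have "\<dots> \<le> (\<integral>x. (max 0 (x - v))\<^sup>2 * f x \<partial>std_normal)"
  proof (rule integral_mono)
    fix x :: real
    define z where "z = x - v"
    have "1 / 8 * (x * f x) + (1 / 32 - v / 8) * f x = f x * (1 / 8 * z + 1 / 32)"
      by (simp add: z_def field_simps)
    moreover have "f x * (1 / 8 * z + 1 / 32) - 1 / 16 * indicator ?J x \<le> (max 0 z)\<^sup>2 * f x"
    proof -
      consider "z \<ge> 1 / 4" | "z \<le> - 1 / 4" | "\<bar>z\<bar> < 1 / 4" by linarith
      then show ?thesis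
      proof cases
        case 1
        have "0 \<le> (z - 1 / 4) * (z + 1 / 8)" using 1 by simp
        then have "1 / 8 * z + 1 / 32 \<le> z\<^sup>2" by (simp add: power2_eq_square algebra_simps)
        then have "f x * (1 / 8 * z + 1 / 32) \<le> f x * z\<^sup>2" by (intro mult_left_mono f0)
        then show ?thesis using 1 by (simp add: z_def max_def mult.commute)
      next
        case 2
        then have "f x * (1 / 8 * z + 1 / 32) \<le> 0" by (intro mult_nonneg_nonpos f0) simp
        then show ?thesis using 2 by (simp add: z_def)
      next
        case 3
        then have "f x * (1 / 8 * z + 1 / 32) \<le> 1 * (1 / 16)" by (intro mult_mono f1) auto
        then show ?thesis using 3 f0[of x] by (auto simp: z_def intro: order_trans[of _ 0])
      qed
    qed
    ultimately show "1 / 8 * (x * f x) + (1 / 32 - v / 8) * f x - 1 / 16 * indicator ?J x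
        \<le> (max 0 (x - v))\<^sup>2 * f x"
      by (simp add: z_def)
  qed (use int integrable_weight integrable_id_weight in
    \<open>simp_all add: integrable_mult_weight integrable_positive_part_sq\<close>)
  finally show ?thesis .
qed

text \<open>Used for the weight and for its reflection, this yields the two points of the support
  that a supporting line at v requires.\<close>

lemma exists_pos_right:
  assumes "v - m \<le> 1 / 1000"
  shows "\<exists>x>v. 0 < f x"
proof (rule ccontr)
  assume "\<not> ?thesis"
  then have "(max 0 (x - v))\<^sup>2 * f x = 0" for x
    using f0[of x] by (cases "x > v") (auto simp: max_def dest: antisym)
  then have "(\<integral>x. (max 0 (x - v))\<^sup>2 * f x \<partial>std_normal) = (\<integral>x. 0 \<partial>std_normal)"
    by (intro Bochner_Integration.integral_cong refl)
  with positive_part_second_moment[OF assms] \<alpha> show False by simp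
qed

lemma le_tangent_mult:
  assumes "f x \<le> c * exp (- s * (x - v))" shows "f x * exp (s * (x - v)) \<le> c"
proof -
  have "f x * exp (s * (x - v)) \<le> c * exp (- s * (x - v)) * exp (s * (x - v))"
    by (intro mult_right_mono assms) simp
  also have "\<dots> = c" by (simp add: exp_minus)
  finally show ?thesis .
qed

lemma integrable_tilt:
  assumes tangent: "\<And>x. f x \<le> c * exp (- s * (x - v))"
  shows "integrable std_normal (\<lambda>x. f x * exp (s * (x - v)))"
proof (rule std_normal_integrable_bounded[where B=c])
  show "\<bar>f x * exp (s * (x - v))\<bar> \<le> c" for x
    using le_tangent_mult[OF tangent] f0[of x] by simp
qed simp

text \<open>The inequality exp y \<ge> 1 + y, integrated against f; the linear term produces the
  first moment.\<close>

lemma tilt_lower_bound: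
  assumes tangent: "\<And>x. f x \<le> c * exp (- s * (x - v))"
  shows "\<alpha> * (1 - s * (v - m)) \<le> (\<integral>x. f x * exp (s * (x - v)) \<partial>std_normal)"
proof -
  have "\<alpha> * (1 - s * (v - m)) = (\<integral>x. s * (x * f x) + (1 - s * v) * f x \<partial>std_normal)"
    using integrable_weight integrable_id_weight by (simp add: mass mean) (simp add: algebra_simps)
  also have "\<dots> \<le> (\<integral>x. f x * exp (s * (x - v)) \<partial>std_normal)"
  proof (rule integral_mono)
    fix x
    have "f x * (1 + s * (x - v)) \<le> f x * exp (s * (x - v))"
      by (intro mult_left_mono f0 exp_ge_add_one_self)
    then show "s * (x * f x) + (1 - s * v) * f x \<le> f x * exp (s * (x - v))"
      by (simp add: algebra_simps)
  qed (use integrable_weight integrable_id_weight integrable_tilt[OF tangent] in auto)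
  finally show ?thesis .
qed

lemma value_lower_bound_linear:
  assumes tangent: "\<And>x. f x \<le> f v * exp (- s * (x - v))"
  shows "\<alpha> * (1 - s * (v - m)) \<le> f v"
proof -
  have "(\<integral>x. f x * exp (s * (x - v)) \<partial>std_normal) \<le> (\<integral>x. f v \<partial>std_normal)"
  proof (rule integral_mono)
    show "f x * exp (s * (x - v)) \<le> f v" for x by (rule le_tangent_mult[OF tangent])
  qed (use integrable_tilt[OF tangent] in auto)
  also have "\<dots> = f v" using std_normal.prob_space by simp
  finally show ?thesis using tilt_lower_bound[OF tangent] by simp
qed

text \<open>The linear bound for exp is kept to the left of v, while to the right the quadratic
  Taylor term is added. It contributes s^2 / 2 times the second moment \<alpha> / 200.\<close>

lemma value_lower_bound_quadratic:
  assumes tangent: "\<And>x. f x \<le> f v * exp (- s * (x - v))"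
    and s: "0 \<le> s" and v: "v - m \<le> 1 / 1000"
  shows "\<alpha> * (1 - s * (v - m) + s\<^sup>2 / 400) \<le> f v"
proof -
  have "\<alpha> * (1 - s * (v - m) + s\<^sup>2 / 400)
      \<le> \<alpha> * (1 - s * (v - m)) + s\<^sup>2 / 2 * (\<integral>x. (max 0 (x - v))\<^sup>2 * f x \<partial>std_normal)"
    using mult_left_mono[OF positive_part_second_moment[OF v], of "s\<^sup>2 / 2"]
    by (simp add: algebra_simps)
  also have "\<dots> = (\<integral>x. s * (x * f x) + (1 - s * v) * f x + s\<^sup>2 / 2 * ((max 0 (x - v))\<^sup>2 * f x) \<partial>std_normal)"
    using integrable_weight integrable_id_weight integrable_mult_weight[OF integrable_positive_part_sq, of v]
    by (simp add: mass mean) (simp add: algebra_simps)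
  also have "\<dots> \<le> (\<integral>x. f v \<partial>std_normal)"
  proof (rule integral_mono)
    fix x
    have "1 + s * (x - v) + s\<^sup>2 / 2 * (max 0 (x - v))\<^sup>2 \<le> exp (s * (x - v))"
    proof (cases "x \<ge> v")
      case True
      then show ?thesis
        using exp_lower_Taylor_quadratic[of "s * (x - v)"] s by (simp add: power_mult_distrib)
    next
      case False
      then show ?thesis by (simp add: max_def)
    qed
    then have "f x * (1 + s * (x - v) + s\<^sup>2 / 2 * (max 0 (x - v))\<^sup>2) \<le> f x * exp (s * (x - v))"
      by (intro mult_left_mono f0)
    also have "\<dots> \<le> f v" by (rule le_tangent_mult[OF tangent])
    finally show "s * (x * f x) + (1 - s * v) * f x + s\<^sup>2 / 2 * ((max 0 (x - v))\<^sup>2 * f x) \<le> f v"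
      by (simp add: algebra_simps)
  qed (use integrable_weight integrable_id_weight integrable_mult_weight[OF integrable_positive_part_sq, of v] in auto)
  also have "\<dots> = f v" using std_normal.prob_space by simp
  finally show ?thesis .
qed

text \<open>The tilted weight \<open>f x * exp (s * (x - v))\<close> never exceeds
  \<open>f v\<close>. At a point of deficit left of v the tilt only decreases f, so the gap there is
  at least the deficit minus \<open>\<alpha> - f v\<close>; elsewhere
  \<open>f v \<le> \<alpha>\<close> makes this true as well. Integrating, the deficit is at most
  \<alpha> minus the integral of the tilted weight, which \<open>tilt_lower_bound\<close>
  controls.\<close>

lemma deficit_mass_le:
  assumes tangent: "\<And>x. f x \<le> f v * exp (- s * (x - v))"
    and s: "0 \<le> s" and v: "f v \<le> \<alpha>"
  shows "(\<integral>x. max 0 (\<alpha> - f x) * indicator {..<v} x \<partial>std_normal) \<le> \<alpha> * s * (v - m)"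
proof -
  let ?N = "\<lambda>x. max 0 (\<alpha> - f x) * indicator {..<v} x"
  have N: "integrable std_normal ?N"
    by (rule std_normal_integrable_bounded[where B=\<alpha>]) (use f0 \<alpha> in \<open>auto simp: indicator_def\<close>)
  have "(\<integral>x. ?N x \<partial>std_normal) - (\<alpha> - f v) + (\<integral>x. f x * exp (s * (x - v)) \<partial>std_normal)
      = (\<integral>x. ?N x - (\<alpha> - f v) + f x * exp (s * (x - v)) \<partial>std_normal)"
    using N integrable_tilt[OF tangent] std_normal.prob_space by simp
  also have "\<dots> \<le> (\<integral>x. f v \<partial>std_normal)"
  proof (rule integral_mono)
    fix x
    have le: "f x * exp (s * (x - v)) \<le> f v" by (rule le_tangent_mult[OF tangent])
    show "?N x - (\<alpha> - f v) + f x * exp (s * (x - v)) \<le> f v"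
    proof (cases "x < v \<and> f x < \<alpha>")
      case True
      then have "s * (x - v) \<le> 0" using s by (intro mult_nonneg_nonpos) auto
      then have "f x * exp (s * (x - v)) \<le> f x" by (intro mult_left_le f0) auto
      then show ?thesis using True by simp
    next
      case False
      then have N0: "?N x = 0" by (auto simp: indicator_def)
      show ?thesis unfolding N0 using le v by linarith
    qed
  qed (use N integrable_tilt[OF tangent] in auto)
  also have "\<dots> = f v" using std_normal.prob_space by simp
  finally show ?thesis
    using tilt_lower_bound[OF tangent] by (simp add: algebra_simps)
qed

text \<open>
  The factor \<open>f x - \<alpha>\<close> has total mass \<open>0\<close>, so its first moment is \<open>\<alpha> m\<close>. To the right of \<open>v\<close> it
  is at most \<open>\<alpha> (exp (- s (x - v)) - 1)\<close>; this has to be compensated by a deficit on the left.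
  The deficit mass is of order \<open>s (v - m)\<close> only, so that it must sit at distance of
  order \<open>1 / v\<close>, where the Gaussian measure is tiny.
\<close>

lemma first_moment_bound:
  assumes tangent: "\<And>x. f x \<le> f v * exp (- s * (x - v))"
    and s: "0 \<le> s" and v: "f v \<le> \<alpha>" and "0 \<le> v" and r: "v \<le> r"
  shows "m + s * (1 / 2 - v - s / 2) \<le> (r + v) * (s * (v - m)) + 2 * std_normal_density r"
proof -
  let ?N = "\<lambda>x. max 0 (\<alpha> - f x) * indicator {..<v} x"
  have N: "integrable std_normal ?N"
    by (rule std_normal_integrable_bounded[where B=\<alpha>]) (use f0 \<alpha> in \<open>auto simp: indicator_def\<close>)
  let ?t = "\<lambda>x. - x * indicator {x. x < - r} x"
  have t: "integrable std_normal ?t" "(\<integral>x. ?t x \<partial>std_normal) = std_normal_density r"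
    using std_normal_tail_moment[of r] r \<open>0 \<le> v\<close> by auto
  \<comment> \<open>These are the first three powers of the positive part of x, written in x and its
    absolute value so that their integrals reduce to the known (absolute) moments.\<close>
  let ?p1 = "\<lambda>x::real. (x + \<bar>x\<bar>) / 2"
  let ?p2 = "\<lambda>x::real. (x\<^sup>2 + x * \<bar>x\<bar>) / 2"
  let ?p3 = "\<lambda>x::real. (x ^ 3 + \<bar>x\<bar> ^ 3) / 2"
  have i2: "integrable std_normal (\<lambda>x::real. x * \<bar>x\<bar>)"
    by (rule Bochner_Integration.integrable_bound[OF integrable_std_normal_power[of 2]])
       (auto simp: power2_eq_square abs_mult)
  have "(\<integral>x. - (x * \<bar>x\<bar>) \<partial>std_normal) = (\<integral>x. x * \<bar>x\<bar> \<partial>std_normal)"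
    using integral_std_normal_uminus[of "\<lambda>x. x * \<bar>x\<bar>"] by simp
  then have e2: "(\<integral>x. x * \<bar>x\<bar> \<partial>std_normal) = 0" by simp
  have p1: "integrable std_normal ?p1" "(\<integral>x. ?p1 x \<partial>std_normal) \<le> 1 / 2"
    using sqrt_2_div_pi_le_1 by (simp_all add: std_normal_moments)
  have p2: "integrable std_normal ?p2" "(\<integral>x. ?p2 x \<partial>std_normal) = 1 / 2"
    using i2 e2 by (simp_all add: std_normal_moments)
  have p3: "integrable std_normal ?p3" "(\<integral>x. ?p3 x \<partial>std_normal) \<le> 1"
    using sqrt_2_div_pi_le_1 by (simp_all add: std_normal_moments)
  have a0: "0 < \<alpha>" using \<alpha> by simp
  have "\<alpha> * m = (\<integral>x. x * f x - v * f x - \<alpha> * x + \<alpha> * v \<partial>std_normal)"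
    using integrable_weight integrable_id_weight std_normal.prob_space
    by (simp add: mass mean std_normal_moments)
  \<comment> \<open>Pointwise: a deficit at a point of [-r, v) is weighted by a distance of at most
    r + v, one beyond -r is bounded crudely by \<alpha>, and to the right of v the tangent gives a
    negative contribution.\<close>
  also have "\<dots> \<le> (\<integral>x. (r + v) * ?N x + 2 * \<alpha> * ?t x
      - \<alpha> * s * (?p2 x - 2 * v * ?p1 x - s / 2 * ?p3 x) \<partial>std_normal)"
  proof (rule integral_mono)
    fix x :: real
    have eq: "x * f x - v * f x - \<alpha> * x + \<alpha> * v = (x - v) * (f x - \<alpha>)" by (simp add: algebra_simps)
    \<comment> \<open>The gain to the right of v, extended to x > 0 so that its integral is
      explicit: x^2 - 2 v x is (x - v)^2 without the v^2, and it is nonpositive for 0 < x \<le> v,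
      so the extension only weakens the bound.\<close>
    define A where "A = s * (?p2 x - 2 * v * ?p1 x - s / 2 * ?p3 x)"
    have "(x - v) * (f x - \<alpha>) \<le> (r + v) * ?N x + 2 * \<alpha> * ?t x - \<alpha> * A"
    proof (cases "x \<le> v")
      case True
      have "A \<le> 0"
      proof (cases "x \<le> 0")
        case True
        then show ?thesis by (simp add: A_def power2_eq_square)
      next
        case False
        then have "?p2 x - 2 * v * ?p1 x - s / 2 * ?p3 x = x * (x - 2 * v) - s / 2 * x ^ 3"
          by (simp add: power2_eq_square algebra_simps)
        also have "\<dots> \<le> 0"
        proof -
          have "x * (x - 2 * v) \<le> 0" using False True by (intro mult_nonneg_nonpos) auto
          moreover have "0 \<le> s / 2 * x ^ 3" using False s by simp
          ultimately show ?thesis by linarith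
        qed
        finally show ?thesis unfolding A_def using s by (rule mult_nonneg_nonpos[rotated])
      qed
      then have A: "\<alpha> * A \<le> 0" using a0 by (simp add: mult_nonneg_nonpos)
      have t0: "0 \<le> ?t x" using r \<open>0 \<le> v\<close> by (simp add: indicator_def)
      have N0: "0 \<le> ?N x" by simp
      show ?thesis
      proof (cases "f x \<ge> \<alpha> \<or> x = v")
        case T: True
        then have "(x - v) * (f x - \<alpha>) \<le> 0" using True by (auto intro: mult_nonpos_nonneg)
        moreover have "0 \<le> (r + v) * ?N x" using r \<open>0 \<le> v\<close> N0 by (intro mult_nonneg_nonneg) auto
        moreover have "0 \<le> 2 * \<alpha> * ?t x" by (rule mult_nonneg_nonneg[OF _ t0]) (use a0 in simp)
        ultimately show ?thesis using A by linarith
      next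
        case F: False
        then have Nx: "?N x = \<alpha> - f x" using True by simp
        show ?thesis
        proof (cases "x < - r")
          case far: True
          have "(x - v) * (f x - \<alpha>) = (v - x) * (\<alpha> - f x)" by (simp add: algebra_simps)
          \<comment> \<open>Here v \<le> r < - x, hence v - x \<le> - 2 x.\<close>
          also have "\<dots> \<le> (- 2 * x) * \<alpha>"
            using far r \<open>0 \<le> v\<close> f0[of x] F by (intro mult_mono) auto
          also have "\<dots> = 2 * \<alpha> * ?t x" using far by simp
          moreover have "0 \<le> (r + v) * ?N x" using r \<open>0 \<le> v\<close> N0 by (intro mult_nonneg_nonneg) auto
          ultimately show ?thesis using A by linarith
        next
          case False
          have "(x - v) * (f x - \<alpha>) = (v - x) * (\<alpha> - f x)" by (simp add: algebra_simps)
          also have "\<dots> \<le> (r + v) * (\<alpha> - f x)"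
            using False F by (intro mult_right_mono) auto
          moreover have "0 \<le> 2 * \<alpha> * ?t x" by (rule mult_nonneg_nonneg[OF _ t0]) (use a0 in simp)
          ultimately show ?thesis unfolding Nx using A by linarith
        qed
      qed
    next
      case False
      then have x: "x > v" by simp
      then have x0: "x > 0" using \<open>0 \<le> v\<close> by simp
      define z where "z = x - v"
      have z: "0 < z" "z \<le> x" using x \<open>0 \<le> v\<close> by (auto simp: z_def)
      have "f x \<le> \<alpha> * exp (- s * z)"
        using order_trans[OF tangent[of x] mult_right_mono[OF v]] by (simp add: z_def)
      moreover have "exp (- s * z) \<le> 1 - s * z + (s * z)\<^sup>2 / 2"
      proof -
        have "0 \<le> s * z" using s z by simp
        then show ?thesis using exp_minus_le_quadratic[of "s * z"] by simp
      qed
      then have "\<alpha> * exp (- s * z) \<le> \<alpha> * (1 - s * z + (s * z)\<^sup>2 / 2)"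
        using a0 by (intro mult_left_mono) auto
      ultimately have "f x - \<alpha> \<le> \<alpha> * (- s * z + (s * z)\<^sup>2 / 2)"
        unfolding ring_distribs by simp
      then have "z * (f x - \<alpha>) \<le> z * (\<alpha> * (- s * z + (s * z)\<^sup>2 / 2))"
        using z by (intro mult_left_mono) auto
      also have "\<dots> = - \<alpha> * s * (z\<^sup>2 - s / 2 * z ^ 3)"
        by (simp add: power2_eq_square power3_eq_cube algebra_simps)
      also have "\<dots> \<le> - \<alpha> * s * (x\<^sup>2 - 2 * v * x - s / 2 * x ^ 3)"
      proof -
        have "z ^ 3 \<le> x ^ 3" using z by (intro power_mono) auto
        then have "s / 2 * z ^ 3 \<le> s / 2 * x ^ 3" using s by (intro mult_left_mono) auto
        moreover have "z\<^sup>2 = x\<^sup>2 - 2 * v * x + v\<^sup>2" by (simp add: z_def power2_eq_square algebra_simps)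
        moreover have "0 \<le> v\<^sup>2" by simp
        ultimately have "x\<^sup>2 - 2 * v * x - s / 2 * x ^ 3 \<le> z\<^sup>2 - s / 2 * z ^ 3" by linarith
        moreover have "- \<alpha> * s \<le> 0" using a0 s by simp
        ultimately show ?thesis by (rule mult_left_mono_neg)
      qed
      also have "\<dots> = - \<alpha> * A"
        using x0 by (simp add: A_def power2_eq_square algebra_simps)
      finally have "(x - v) * (f x - \<alpha>) \<le> - \<alpha> * A" by (simp add: z_def)
      moreover have "?N x = 0" "?t x = 0" using x0 x r \<open>0 \<le> v\<close> by auto
      ultimately show ?thesis by (simp only: mult_zero_right)
    qed
    then show "x * f x - v * f x - \<alpha> * x + \<alpha> * v \<le> (r + v) * ?N x + 2 * \<alpha> * ?t x
        - \<alpha> * s * (?p2 x - 2 * v * ?p1 x - s / 2 * ?p3 x)"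
      by (simp add: eq A_def mult.assoc)
  next
    show "integrable std_normal (\<lambda>x. x * f x - v * f x - \<alpha> * x + \<alpha> * v)"
      using integrable_weight integrable_id_weight by simp
    show "integrable std_normal (\<lambda>x. (r + v) * ?N x + 2 * \<alpha> * ?t x
        - \<alpha> * s * (?p2 x - 2 * v * ?p1 x - s / 2 * ?p3 x))"
      using N t(1) p1(1) p2(1) p3(1)
      by (intro Bochner_Integration.integrable_add Bochner_Integration.integrable_diff integrable_mult_right)
  qed
  also have "\<dots> = (r + v) * (\<integral>x. ?N x \<partial>std_normal) + 2 * \<alpha> * std_normal_density r
      - \<alpha> * s * (1 / 2 - 2 * v * (\<integral>x. ?p1 x \<partial>std_normal) - s / 2 * (\<integral>x. ?p3 x \<partial>std_normal))"
    unfolding t(2)[symmetric] p2(2)[symmetric] using N t(1) p1(1) p2(1) p3(1)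
    by (simp only: Bochner_Integration.integral_add Bochner_Integration.integral_diff
      Bochner_Integration.integrable_add Bochner_Integration.integrable_diff
      integrable_mult_right integral_mult_right_zero)
  also have "\<dots> \<le> (r + v) * (\<alpha> * s * (v - m)) + 2 * \<alpha> * std_normal_density r
      - \<alpha> * s * (1 / 2 - v - s / 2)"
  proof -
    have "(r + v) * (\<integral>x. ?N x \<partial>std_normal) \<le> (r + v) * (\<alpha> * s * (v - m))"
      using deficit_mass_le[OF tangent s v] r \<open>0 \<le> v\<close> by (intro mult_left_mono) auto
    moreover have "\<alpha> * s * (1 / 2 - v - s / 2) \<le>
        \<alpha> * s * (1 / 2 - 2 * v * (\<integral>x. ?p1 x \<partial>std_normal) - s / 2 * (\<integral>x. ?p3 x \<partial>std_normal))"
    proof (rule mult_left_mono)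
      have "2 * v * (\<integral>x. ?p1 x \<partial>std_normal) \<le> 2 * v * (1 / 2)"
        using p1(2) \<open>0 \<le> v\<close> by (intro mult_left_mono) auto
      moreover have "s / 2 * (\<integral>x. ?p3 x \<partial>std_normal) \<le> s / 2 * 1"
        using p3(2) s by (intro mult_left_mono) auto
      ultimately show "1 / 2 - v - s / 2 \<le>
        1 / 2 - 2 * v * (\<integral>x. ?p1 x \<partial>std_normal) - s / 2 * (\<integral>x. ?p3 x \<partial>std_normal)" by simp
    qed (use a0 s in simp)
    ultimately show ?thesis by linarith
  qed
  finally have "\<alpha> * (m + s * (1 / 2 - v - s / 2))
      \<le> \<alpha> * ((r + v) * (s * (v - m)) + 2 * std_normal_density r)"
    by (simp add: algebra_simps)
  then show ?thesis using a0 by simp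
qed

end

lemma (in gaussian_weight) value_lower_bound_tangent:
  assumes tangent: "\<And>x. f x \<le> f v * exp (- s * (x - v))" and s: "0 \<le> s"
    and m: "\<bar>m\<bar> \<le> \<eta>" and \<eta>: "\<eta> \<le> 1 / 100000" and v: "\<bar>v\<bar> \<le> 1 / 10000"
  shows "\<alpha> * (1 - \<eta>) \<le> f v
    \<or> v \<noteq> 0 \<and> \<alpha> * (1 - exp (- 1 / (100 * v\<^sup>2)) / (4 * sqrt (2 * pi))) \<le> f v"
proof -
  define w where "w = v - m"
  have w: "w \<le> 11 / 100000" using m \<eta> v by (simp add: w_def)
  have a0: "0 < \<alpha>" and \<eta>0: "0 \<le> \<eta>" using \<alpha> m by auto
  have lin: "\<alpha> * (1 - s * w) \<le> f v" using value_lower_bound_linear[OF tangent] by (simp add: w_def)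
  have small: ?thesis if "s * w \<le> \<eta>"
  proof -
    have "\<alpha> * (1 - \<eta>) \<le> \<alpha> * (1 - s * w)" using that a0 by simp
    then show ?thesis using lin by linarith
  qed
  \<comment> \<open>Steep slopes: s^2 / 400 beats s w because w \<le> 11/100000 < 1/8000. The third
    and fourth cases give s w \<le> \<eta>. In the last case m lies between - s/20 and v/10, and
    only there is the first moment needed.\<close>
  consider "s \<ge> 1 / 20" | "w \<le> 0" | "s < 1 / 20" "0 < w" "v \<le> 10 * \<eta>" | "0 < w" "s \<le> 20 * \<eta>"
    | "\<alpha> \<le> f v"
    | "s < 1 / 20" "0 < w" "10 * \<eta> < v" "20 * \<eta> < s" "f v < \<alpha>" by linarith
  then show ?thesis
  proof cases
    case 1
    have "0 \<le> s * (s / 400 - w)" using 1 w s by (intro mult_nonneg_nonneg) auto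
    then have "1 - \<eta> \<le> 1 - s * w + s\<^sup>2 / 400" using \<eta>0 by (simp add: power2_eq_square algebra_simps)
    then have "\<alpha> * (1 - \<eta>) \<le> \<alpha> * (1 - s * w + s\<^sup>2 / 400)" using a0 by (intro mult_left_mono) auto
    then show ?thesis using value_lower_bound_quadratic[OF tangent s] w by (simp add: w_def)
  next
    case 2
    then have "s * w \<le> 0" using s by (simp add: mult_nonneg_nonpos)
    then show ?thesis using small \<eta>0 by simp
  next
    case 3
    have "s * w \<le> 1 / 20 * (11 * \<eta>)" using 3 s m by (intro mult_mono) (auto simp: w_def)
    then show ?thesis using small \<eta>0 by simp
  next
    case 4
    have "s * w \<le> 20 * \<eta> * (1 / 20)" using 4 s w \<eta>0 by (intro mult_mono) auto
    then show ?thesis using small by simp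
  next
    case 5
    have "\<alpha> * (1 - \<eta>) \<le> \<alpha>" using a0 \<eta>0 by (simp add: mult_left_le)
    then show ?thesis using 5 by simp
  next
    case 6
    have v0: "0 < v" using 6 \<eta>0 by simp
    have wv: "w \<le> 11 / 10 * v" using 6 m by (simp add: w_def)
    have v2: "v * v \<le> 1 / 10000 * (1 / 10000)" using v v0 by (intro mult_mono) auto
    \<comment> \<open>The near deficit then costs at most 11/10 * (19/100 + v^2) \<le> 21/100 times
      s, against an available 9/20 - 1/20 = 2/5, while r^2 / 2 = 361 / (20000 v^2) exceeds the
      required 1 / (100 v^2).\<close>
    define r where "r = 19 / (100 * v)"
    define d where "d = std_normal_density r"
    have d0: "0 \<le> d" by (simp add: d_def)
    have rv: "r * v = 19 / 100" using v0 by (simp add: r_def)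
    have r0: "0 < r" using v0 by (simp add: r_def)
    have "v \<le> r" using v2 v0 by (simp add: r_def field_simps)
    then have "m + s * (1 / 2 - v - s / 2) \<le> (r + v) * (s * w) + 2 * std_normal_density r"
      using first_moment_bound[OF tangent s _ _ \<open>v \<le> r\<close>] 6 v0 by (simp add: w_def)
    moreover have "(r + v) * (s * w) \<le> s * (21 / 100)"
    proof -
      have "(r + v) * w \<le> (r + v) * (11 / 10 * v)" using wv r0 v0 by (intro mult_left_mono) auto
      also have "\<dots> = 11 / 10 * (r * v + v * v)" by (simp add: algebra_simps)
      also have "\<dots> \<le> 21 / 100" using v2 by (simp add: rv)
      finally have "s * ((r + v) * w) \<le> s * (21 / 100)" using s by (rule mult_left_mono)
      then show ?thesis by (simp add: algebra_simps)
    qed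
    moreover have "- s / 20 \<le> m" using 6 m by simp
    moreover have "s * (9 / 20) \<le> s * (1 / 2 - v - s / 2)"
      using s v 6 by (intro mult_left_mono) auto
    ultimately have "s * (9 / 20 - 1 / 20 - 21 / 100) \<le> 2 * std_normal_density r" by (simp add: algebra_simps)
    then have s_le: "s \<le> 11 * d" using d0 by (simp add: d_def[symmetric])
    \<comment> \<open>The generous bound w \<le> 1/44 turns 11 d into d / 4, which is the factor
      \<open>1 / (4 * sqrt (2 * pi))\<close> of the claim.\<close>
    have "s * w \<le> 11 * d * (1 / 44)"
      using s_le w 6 d0 by (intro mult_mono) auto
    also have "\<dots> = exp (- r\<^sup>2 / 2) / (4 * sqrt (2 * pi))" by (simp add: d_def std_normal_density_def)
    also have "\<dots> \<le> exp (- 1 / (100 * v\<^sup>2)) / (4 * sqrt (2 * pi))"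
    proof -
      have "1 / (100 * v\<^sup>2) \<le> r\<^sup>2 / 2" using v0 by (simp add: r_def field_simps)
      then show ?thesis by (intro divide_right_mono) auto
    qed
    finally have "\<alpha> * (1 - exp (- 1 / (100 * v\<^sup>2)) / (4 * sqrt (2 * pi))) \<le> \<alpha> * (1 - s * w)"
      using a0 by simp
    then show ?thesis using lin v0 by (intro disjI2) auto
  qed
qed

lemma (in gaussian_weight) gaussian_weight_reflect: "gaussian_weight (\<lambda>x. f (- x)) \<alpha> (- m)"
proof
  show "(\<integral>x. f (- x) \<partial>std_normal) = \<alpha>" using integral_std_normal_uminus[OF meas] by (simp add: mass)
  have "(\<integral>x. x * f (- x) \<partial>std_normal) = - (\<integral>x. - x * f (- x) \<partial>std_normal)" by simp
  also have "\<dots> = \<alpha> * - m" using integral_std_normal_uminus[of "\<lambda>x. x * f x"] by (simp add: mean)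
  finally show "(\<integral>x. x * f (- x) \<partial>std_normal) = \<alpha> * - m" .
qed (use f0 f1 \<alpha> in simp_all)

lemma (in gaussian_weight) value_lower_bound:
  assumes lc: "log_concave f"
    and m: "\<bar>m\<bar> \<le> \<eta>" and \<eta>: "\<eta> \<le> 1 / 100000" and v: "\<bar>v\<bar> \<le> 1 / 10000"
  shows "(\<alpha> - \<eta>) * (1 - (if v = 0 then 0 else exp (- 1 / (100 * v\<^sup>2))) / (4 * sqrt (2 * pi))) \<le> f v"
proof -
  interpret reflected: gaussian_weight "\<lambda>x. f (- x)" \<alpha> "- m" by (rule gaussian_weight_reflect)
  define e where "e = (if v = 0 then 0 else exp (- 1 / (100 * v\<^sup>2))) / (4 * sqrt (2 * pi))"
  have "v - m \<le> 1 / 1000" "- v - - m \<le> 1 / 1000" using m \<eta> v by linarith+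
  then obtain a b where b: "v < b" "0 < f b" and a: "- v < a" "0 < f (- a)"
    using exists_pos_right[of v] reflected.exists_pos_right[of "- v"] by blast
  obtain k where k: "\<And>x. f x \<le> f v * exp (k * (x - v))"
    using log_concave_support_line[OF lc, of "- a" v b] a b by auto
  have "\<alpha> * (1 - \<eta>) \<le> f v \<or> v \<noteq> 0 \<and> \<alpha> * (1 - exp (- 1 / (100 * v\<^sup>2)) / (4 * sqrt (2 * pi))) \<le> f v"
  proof (cases "k \<le> 0")
    case True
    then show ?thesis using value_lower_bound_tangent[of v "- k"] k m \<eta> v by simp
  next
    case False
    \<comment> \<open>An increasing tangent at v is a decreasing one for the reflected weight at -
      v; the claimed bound is even in v.\<close>
    have "f (- x) \<le> f (- (- v)) * exp (- k * (x - (- v)))" for x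
    proof -
      have "k * (- x - v) = - k * (x - (- v))" by (simp add: algebra_simps)
      then show ?thesis using k[of "- x"] by (simp only: minus_minus)
    qed
    then show ?thesis
      using reflected.value_lower_bound_tangent[of "- v" k \<eta>] False m \<eta> v by simp
  qed
  then have or: "\<alpha> * (1 - \<eta>) \<le> f v \<or> \<alpha> * (1 - e) \<le> f v" by (auto simp: e_def)
  have e0: "0 \<le> e" by (simp add: e_def)
  have e1: "e \<le> 1"
  proof -
    have "(if v = 0 then 0 else exp (- 1 / (100 * v\<^sup>2))) \<le> 1" by simp
    also have "\<dots> \<le> 4 * sqrt (2 * pi)" using sqrt_2pi_ge_2 by simp
    finally show ?thesis by (simp add: e_def)
  qed
  have a1: "\<alpha> \<le> 1"
  proof -
    have "(\<integral>x. f x \<partial>std_normal) \<le> (\<integral>x. 1 \<partial>std_normal)"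
      by (intro integral_mono integrable_weight) (use f1 in auto)
    then show ?thesis using std_normal.prob_space by (simp add: mass)
  qed
  have \<eta>0: "0 \<le> \<eta>" using m by simp
  have "(\<alpha> - \<eta>) * (1 - e) \<le> (\<alpha> - \<eta>) * 1" using \<alpha> \<eta> e0 by (intro mult_left_mono) auto
  \<comment> \<open>Since \<alpha> \<le> 1, a relative loss of \<eta> is at most an absolute one.
    This is why c_0 = 1 works.\<close>
  also have "\<dots> \<le> \<alpha> * (1 - \<eta>)" using mult_right_mono[OF a1 \<eta>0] by (simp add: algebra_simps)
  finally have 1: "(\<alpha> - \<eta>) * (1 - e) \<le> \<alpha> * (1 - \<eta>)" .
  have 2: "(\<alpha> - \<eta>) * (1 - e) \<le> \<alpha> * (1 - e)" using e1 \<eta>0 by (intro mult_right_mono) auto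
  show ?thesis using or 1 2 unfolding e_def by linarith
qed

section \<open>Marginals of log-concave functions\<close>

lemma minkowski_interval:
  fixes I J L :: "real set"
  assumes I: "convex I" "bounded I" "I \<noteq> {}" and J: "convex J" "bounded J" "J \<noteq> {}"
    and t: "0 < t" "t < 1" and L [measurable]: "L \<in> sets borel"
    and sub: "\<And>x y. x \<in> I \<Longrightarrow> y \<in> J \<Longrightarrow> (1 - t) * x + t * y \<in> L"
  shows "ennreal (1 - t) * emeasure lborel I + ennreal t * emeasure lborel J \<le> emeasure lborel L"
proof -
  have bdd: "bdd_below I" "bdd_above I" "bdd_below J" "bdd_above J"
    using I J by (auto intro: bounded_imp_bdd_below bounded_imp_bdd_above)
  have le: "Inf I \<le> Sup I" "Inf J \<le> Sup J" using bdd I J by (auto intro: cInf_le_cSup)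
  define p q where "p = (1 - t) * Inf I + t * Inf J" and "q = (1 - t) * Sup I + t * Sup J"
  \<comment> \<open>The infima and suprema need not be attained, so z is enclosed between two
    combinations z1 < z < z2 of points near the ends. Convexity of I and J then produces z itself as
    a combination, although L is not assumed convex.\<close>
  have "{p<..<q} \<subseteq> L"
  proof
    fix z assume "z \<in> {p<..<q}"
    then have z: "p < z" "z < q" by auto
    obtain x1 where x1: "x1 \<in> I" "x1 < Inf I + (z - p)"
      using cInf_lessD[of I "Inf I + (z - p)"] I z by auto
    obtain y1 where y1: "y1 \<in> J" "y1 < Inf J + (z - p)"
      using cInf_lessD[of J "Inf J + (z - p)"] J z by auto
    obtain x2 where x2: "x2 \<in> I" "Sup I - (q - z) < x2"
      using less_cSupD[of I "Sup I - (q - z)"] I z by auto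
    obtain y2 where y2: "y2 \<in> J" "Sup J - (q - z) < y2"
      using less_cSupD[of J "Sup J - (q - z)"] J z by auto
    define z1 z2 where "z1 = (1 - t) * x1 + t * y1" and "z2 = (1 - t) * x2 + t * y2"
    have "z1 < (1 - t) * (Inf I + (z - p)) + t * (Inf J + (z - p))"
      unfolding z1_def using t x1 y1 by (intro add_strict_mono mult_strict_left_mono) auto
    then have z1: "z1 < z" by (simp add: p_def algebra_simps)
    have "(1 - t) * (Sup I - (q - z)) + t * (Sup J - (q - z)) < z2"
      unfolding z2_def using t x2 y2 by (intro add_strict_mono mult_strict_left_mono) auto
    then have z2: "z < z2" by (simp add: q_def algebra_simps)
    define r where "r = (z - z1) / (z2 - z1)"
    have r: "0 \<le> r" "r \<le> 1" using z1 z2 by (auto simp: r_def)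
    have "r * (z2 - z1) = z - z1" using z1 z2 by (simp add: r_def)
    then have z: "z = (1 - r) * z1 + r * z2" by (simp add: algebra_simps)
    have "(1 - r) *\<^sub>R x1 + r *\<^sub>R x2 \<in> I" "(1 - r) *\<^sub>R y1 + r *\<^sub>R y2 \<in> J"
      using convexD_alt[OF I(1) x1(1) x2(1) r] convexD_alt[OF J(1) y1(1) y2(1) r] by auto
    then have "(1 - t) * ((1 - r) * x1 + r * x2) + t * ((1 - r) * y1 + r * y2) \<in> L"
      using sub by simp
    also have "(1 - t) * ((1 - r) * x1 + r * x2) + t * ((1 - r) * y1 + r * y2) = z"
      by (simp add: z z1_def z2_def algebra_simps)
    finally show "z \<in> L" .
  qed
  have *: "emeasure lborel X \<le> ennreal (Sup X - Inf X)"
    if "bdd_below X" "bdd_above X" "X \<noteq> {}" for X :: "real set"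
  proof -
    have "X \<subseteq> {Inf X..Sup X}" using that by (auto intro: cInf_lower cSup_upper)
    then have "emeasure lborel X \<le> emeasure lborel {Inf X..Sup X}" by (intro emeasure_mono) auto
    also have "\<dots> = ennreal (Sup X - Inf X)" using that by (simp add: cInf_le_cSup)
    finally show ?thesis .
  qed
  have "ennreal (1 - t) * emeasure lborel I + ennreal t * emeasure lborel J
      \<le> ennreal (1 - t) * ennreal (Sup I - Inf I) + ennreal t * ennreal (Sup J - Inf J)"
    using bdd I J by (intro add_mono mult_left_mono *) auto
  also have "\<dots> = ennreal (q - p)"
  proof -
    have "q - p = (1 - t) * (Sup I - Inf I) + t * (Sup J - Inf J)"
      by (simp add: p_def q_def algebra_simps)
    then show ?thesis using t le by (simp add: ennreal_mult)
  qed
  also have "\<dots> = emeasure lborel {p<..<q}"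
  proof -
    have "p \<le> q" unfolding p_def q_def using t le by (intro add_mono mult_left_mono) auto
    then show ?thesis by simp
  qed
  also have "\<dots> \<le> emeasure lborel L" using \<open>{p<..<q} \<subseteq> L\<close> by (intro emeasure_mono) auto
  finally show ?thesis .
qed

text \<open>Levels above 1 are cut off because the comparison of level sets is available only below
  the common supremum 1 of the two given functions.\<close>

lemma layer_cake_unit:
  fixes a :: "real \<Rightarrow> real"
  assumes [measurable]: "a \<in> borel_measurable borel" and a: "\<And>x. 0 \<le> a x"
  shows "(\<integral>\<^sup>+s. emeasure lborel {x. s < a x} * indicator {0<..<1} s \<partial>lborel)
    = (\<integral>\<^sup>+x. ennreal (min 1 (a x)) \<partial>lborel)"
proof -
  have "(\<integral>\<^sup>+s. emeasure lborel {x. s < a x} * indicator {0<..<1} s \<partial>lborel)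
      = (\<integral>\<^sup>+s. \<integral>\<^sup>+x. indicator {x. s < a x} x * indicator {0<..<1} s \<partial>lborel \<partial>lborel)"
    by (intro nn_integral_cong) (simp add: nn_integral_multc)
  also have "\<dots> = (\<integral>\<^sup>+x. \<integral>\<^sup>+s. indicator {x. s < a x} x * indicator {0<..<1} s \<partial>lborel \<partial>lborel)"
    by (intro lborel_pair.Fubini') measurable
  also have "\<dots> = (\<integral>\<^sup>+x. \<integral>\<^sup>+s. indicator {0<..<min 1 (a x)} s \<partial>lborel \<partial>lborel)"
    by (intro nn_integral_cong) (auto simp: indicator_def)
  also have "\<dots> = (\<integral>\<^sup>+x. ennreal (min 1 (a x)) \<partial>lborel)"
    using a by (intro nn_integral_cong) simp
  finally show ?thesis .
qed

text \<open>With both suprema equal to 1, the level sets of a and b are nonempty for every s in (0,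
  1), and s = s^(1-t) s^t shows that their combinations lie in the level set of c. Integrating the
  interval inequality over s gives even the arithmetic mean of the integrals.\<close>

lemma prekopa_leindler_unit:
  fixes a b c :: "real \<Rightarrow> real"
  assumes [measurable]: "a \<in> borel_measurable borel" "b \<in> borel_measurable borel"
      "c \<in> borel_measurable borel"
    and nonneg: "\<And>x. 0 \<le> a x" "\<And>x. 0 \<le> b x" "\<And>x. 0 \<le> c x"
    and le1: "\<And>x. a x \<le> 1" "\<And>x. b x \<le> 1"
    and ne: "\<And>s. s < 1 \<Longrightarrow> \<exists>x. s < a x" "\<And>s. s < 1 \<Longrightarrow> \<exists>x. s < b x"
    and conv: "\<And>s. 0 < s \<Longrightarrow> convex {x. s < a x}" "\<And>s. 0 < s \<Longrightarrow> convex {x. s < b x}"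
    and bdd: "\<And>s. 0 < s \<Longrightarrow> bounded {x. s < a x}" "\<And>s. 0 < s \<Longrightarrow> bounded {x. s < b x}"
    and t: "0 < t" "t < 1"
    and le: "\<And>x y. a x powr (1 - t) * b y powr t \<le> c ((1 - t) * x + t * y)"
  shows "ennreal (1 - t) * (\<integral>\<^sup>+x. a x \<partial>lborel) + ennreal t * (\<integral>\<^sup>+x. b x \<partial>lborel)
    \<le> (\<integral>\<^sup>+x. c x \<partial>lborel)"
proof -
  have [measurable]: "(\<lambda>s. emeasure lborel {x. s < d x}) \<in> borel_measurable borel"
    if [measurable]: "d \<in> borel_measurable borel" for d :: "real \<Rightarrow> real"
    by measurable
  have *: "(\<integral>\<^sup>+x. d x \<partial>lborel)
      = (\<integral>\<^sup>+s. emeasure lborel {x. s < d x} * indicator {0<..<1} s \<partial>lborel)"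
    if [measurable]: "d \<in> borel_measurable borel" and "\<And>x. 0 \<le> d x" "\<And>x. d x \<le> 1" for d :: "real \<Rightarrow> real"
    using layer_cake_unit[of d] that by (simp add: min_absorb2)
  have "ennreal (1 - t) * (\<integral>\<^sup>+x. a x \<partial>lborel) + ennreal t * (\<integral>\<^sup>+x. b x \<partial>lborel)
      = (\<integral>\<^sup>+s. (ennreal (1 - t) * emeasure lborel {x. s < a x}
          + ennreal t * emeasure lborel {x. s < b x}) * indicator {0<..<1} s \<partial>lborel)"
    using nonneg le1
    by (simp add: * distrib_right nn_integral_add nn_integral_cmult mult.assoc)
  also have "\<dots> \<le> (\<integral>\<^sup>+s. emeasure lborel {x. s < c x} * indicator {0<..<1} s \<partial>lborel)"
  proof (intro nn_integral_mono)
    fix s :: real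
    have "ennreal (1 - t) * emeasure lborel {x. s < a x} + ennreal t * emeasure lborel {x. s < b x}
        \<le> emeasure lborel {x. s < c x}" if s: "0 < s" "s < 1"
    proof (rule minkowski_interval[OF conv(1) bdd(1) _ conv(2) bdd(2) _ t])
      fix x y assume "x \<in> {x. s < a x}" "y \<in> {x. s < b x}"
      then have xy: "s < a x" "s < b y" by auto
      have "s = s powr (1 - t) * s powr t" using s by (simp add: powr_add[symmetric])
      also have "\<dots> < a x powr (1 - t) * b y powr t"
        using xy s t by (intro mult_strict_mono powr_less_mono2) auto
      also have "\<dots> \<le> c ((1 - t) * x + t * y)" by (rule le)
      finally show "(1 - t) * x + t * y \<in> {x. s < c x}" by simp
    qed (use s ne in auto)
    then show "(ennreal (1 - t) * emeasure lborel {x. s < a x}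
          + ennreal t * emeasure lborel {x. s < b x}) * indicator {0<..<1} s
        \<le> emeasure lborel {x. s < c x} * indicator {0<..<1} s"
      by (auto simp: indicator_def)
  qed
  also have "\<dots> = (\<integral>\<^sup>+x. ennreal (min 1 (c x)) \<partial>lborel)"
    using nonneg by (intro layer_cake_unit) auto
  also have "\<dots> \<le> (\<integral>\<^sup>+x. c x \<partial>lborel)" by (intro nn_integral_mono ennreal_leI) simp
  finally show ?thesis .
qed

text \<open>Dividing a and b by their suprema p and q, and c by p^(1-t) q^t, reduces to suprema 1.
  The weighted AM-GM inequality passes from the arithmetic to the geometric mean, in which the
  scaling factors cancel.\<close>

lemma prekopa_leindler_interval:
  fixes a b c :: "real \<Rightarrow> real"
  assumes int: "integrable lborel a" "integrable lborel b" "integrable lborel c"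
    and nonneg: "\<And>x. 0 \<le> a x" "\<And>x. 0 \<le> b x" "\<And>x. 0 \<le> c x"
    and le1: "\<And>x. a x \<le> 1" "\<And>x. b x \<le> 1"
    and conv: "\<And>s. 0 < s \<Longrightarrow> convex {x. s < a x}" "\<And>s. 0 < s \<Longrightarrow> convex {x. s < b x}"
    and bdd: "\<And>s. 0 < s \<Longrightarrow> bounded {x. s < a x}" "\<And>s. 0 < s \<Longrightarrow> bounded {x. s < b x}"
    and t: "0 < t" "t < 1"
    and le: "\<And>x y. a x powr (1 - t) * b y powr t \<le> c ((1 - t) * x + t * y)"
  shows "(\<integral>x. a x \<partial>lborel) powr (1 - t) * (\<integral>x. b x \<partial>lborel) powr t \<le> (\<integral>x. c x \<partial>lborel)"
proof (cases "(\<integral>x. a x \<partial>lborel) = 0 \<or> (\<integral>x. b x \<partial>lborel) = 0")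
  case True
  then show ?thesis using nonneg by auto
next
  case False
  define A where "A = (\<integral>x. a x \<partial>lborel)"
  define B where "B = (\<integral>x. b x \<partial>lborel)"
  have A: "0 < A" and B: "0 < B"
    using False nonneg unfolding A_def B_def by (auto simp: less_le)
  have *: "\<exists>x. d x \<noteq> 0" if "(\<integral>x. d x \<partial>lborel) \<noteq> 0" for d :: "real \<Rightarrow> real"
  proof (rule ccontr)
    assume "\<not> ?thesis"
    then have "d = (\<lambda>_. 0)" by auto
    with that show False by simp
  qed
  have "\<exists>x. a x \<noteq> 0" "\<exists>x. b x \<noteq> 0" using False * by auto
  then obtain x0 y0 where x0: "0 < a x0" and y0: "0 < b y0" using nonneg by (metis less_le)
  define p q where "p = Sup (range a)" and "q = Sup (range b)"
  have bd: "bdd_above (range a)" "bdd_above (range b)" using le1 by (auto intro!: bdd_aboveI[of _ 1])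
  have ap: "a x \<le> p" and bq: "b x \<le> q" for x
    unfolding p_def q_def using bd by (auto intro: cSup_upper)
  have p: "0 < p" and q: "0 < q" using ap[of x0] bq[of y0] x0 y0 by auto
  define r where "r = p powr (1 - t) * q powr t"
  have r: "0 < r" using p q by (simp add: r_def)
  have [measurable]: "a \<in> borel_measurable borel" "b \<in> borel_measurable borel" "c \<in> borel_measurable borel"
    using int by auto
  have "ennreal (1 - t) * (\<integral>\<^sup>+x. a x / p \<partial>lborel) + ennreal t * (\<integral>\<^sup>+x. b x / q \<partial>lborel)
      \<le> (\<integral>\<^sup>+x. c x / r \<partial>lborel)"
  proof (rule prekopa_leindler_unit[OF _ _ _ _ _ _ _ _ _ _ _ _ _ _ t])
    show "a x / p \<le> 1" "b x / q \<le> 1" for x using ap bq p q by auto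
    show "\<exists>x. s < a x / p" if "s < 1" for s
      using less_cSupD[of "range a" "s * p"] that p by (auto simp: p_def[symmetric] field_simps)
    show "\<exists>x. s < b x / q" if "s < 1" for s
      using less_cSupD[of "range b" "s * q"] that q by (auto simp: q_def[symmetric] field_simps)
    show "convex {x. s < a x / p}" "bounded {x. s < a x / p}" if "0 < s" for s
      using conv(1)[of "s * p"] bdd(1)[of "s * p"] that p by (simp_all add: field_simps)
    show "convex {x. s < b x / q}" "bounded {x. s < b x / q}" if "0 < s" for s
      using conv(2)[of "s * q"] bdd(2)[of "s * q"] that q by (simp_all add: field_simps)
    show "(a x / p) powr (1 - t) * (b y / q) powr t \<le> c ((1 - t) * x + t * y) / r" for x y
      using divide_right_mono[OF le[of x y], of r] r nonneg p q by (simp add: powr_divide r_def)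
  qed (use nonneg p q r in auto)
  then have "ennreal (1 - t) * ennreal (A / p) + ennreal t * ennreal (B / q)
      \<le> ennreal ((\<integral>x. c x \<partial>lborel) / r)"
    using nonneg p q r int by (simp add: nn_integral_eq_integral A_def[symmetric] B_def[symmetric])
  then have "ennreal ((1 - t) * (A / p) + t * (B / q)) \<le> ennreal ((\<integral>x. c x \<partial>lborel) / r)"
    using p q t A B by (simp flip: ennreal_mult ennreal_plus)
  then have "(1 - t) * (A / p) + t * (B / q) \<le> (\<integral>x. c x \<partial>lborel) / r"
    using nonneg r by (subst (asm) ennreal_le_iff) auto
  moreover have "(A / p) powr (1 - t) * (B / q) powr t \<le> (1 - t) * (A / p) + t * (B / q)"
    using t A B p q by (intro Youngs_inequality_0) auto
  moreover have "(A / p) powr (1 - t) * (B / q) powr t = (A powr (1 - t) * B powr t) / r"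
    using A B p q by (simp add: powr_divide r_def)
  ultimately have "(A powr (1 - t) * B powr t) / r \<le> (\<integral>x. c x \<partial>lborel) / r" by simp
  then show ?thesis using r by (simp add: A_def B_def divide_le_cancel)
qed

section \<open>Gaussian marginals of log-concave functions\<close>

lemma log_concave_mult:
  assumes "log_concave f" "log_concave g"
  shows "log_concave (\<lambda>x. f x * g x)"
  unfolding log_concave_def
proof (intro conjI allI impI)
  fix x y t :: real
  assume t: "0 < t" "t < 1"
  have "(f x * g x) powr (1 - t) * (f y * g y) powr t
      = (f x powr (1 - t) * f y powr t) * (g x powr (1 - t) * g y powr t)"
    using assms by (simp add: powr_mult log_concave_nonneg)
  also have "\<dots> \<le> f ((1 - t) * x + t * y) * g ((1 - t) * x + t * y)"
    using assms t by (intro mult_mono log_concaveD) (auto simp: log_concave_nonneg)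
  finally show "(f x * g x) powr (1 - t) * (f y * g y) powr t
      \<le> f ((1 - t) * x + t * y) * g ((1 - t) * x + t * y)" .
qed (use assms in \<open>simp add: log_concave_nonneg\<close>)

lemma log_concave_std_normal_density: "log_concave std_normal_density"
  unfolding log_concave_def
proof (intro conjI allI impI)
  fix x y t :: real
  assume t: "0 < t" "t < 1"
  define c where "c = 1 / sqrt (2 * pi)"
  have c: "0 < c" by (simp add: c_def)
  have d: "std_normal_density z = c * exp (- z\<^sup>2 / 2)" for z
    by (simp add: std_normal_density_def c_def)
  have "((1 - t) * x + t * y)\<^sup>2 = (1 - t) * x\<^sup>2 + t * y\<^sup>2 - t * (1 - t) * (x - y)\<^sup>2"
    by (simp add: power2_eq_square algebra_simps)
  moreover have "0 \<le> t * (1 - t) * (x - y)\<^sup>2" using t by simp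
  ultimately have "- ((1 - t) * x\<^sup>2 + t * y\<^sup>2) / 2 \<le> - ((1 - t) * x + t * y)\<^sup>2 / 2" by simp
  then have "exp (- ((1 - t) * x\<^sup>2 + t * y\<^sup>2) / 2) \<le> exp (- ((1 - t) * x + t * y)\<^sup>2 / 2)" by simp
  then have le: "c * exp (- ((1 - t) * x\<^sup>2 + t * y\<^sup>2) / 2) \<le> c * exp (- ((1 - t) * x + t * y)\<^sup>2 / 2)"
    using c by (intro mult_left_mono) auto
  have "(c * exp (- x\<^sup>2 / 2)) powr (1 - t) * (c * exp (- y\<^sup>2 / 2)) powr t
      = (c powr (1 - t) * c powr t) * (exp ((- x\<^sup>2 / 2) * (1 - t)) * exp ((- y\<^sup>2 / 2) * t))"
    using c by (simp add: powr_mult exp_powr_real)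
  also have "c powr (1 - t) * c powr t = c" using c by (simp add: powr_add[symmetric])
  also have "exp ((- x\<^sup>2 / 2) * (1 - t)) * exp ((- y\<^sup>2 / 2) * t)
      = exp (- ((1 - t) * x\<^sup>2 + t * y\<^sup>2) / 2)"
    by (simp add: exp_add[symmetric] field_simps)
  finally show "std_normal_density x powr (1 - t) * std_normal_density y powr t
      \<le> std_normal_density ((1 - t) * x + t * y)"
    using le by (simp only: d)
qed simp

text \<open>Provides the bounded level sets for Prekopa-Leindler, whatever the shape of the factor
  multiplying the density.\<close>

lemma bounded_superlevel_std_normal_density:
  assumes s: "0 < s" and le: "\<And>x. f x \<le> std_normal_density x"
  shows "bounded {x. s < f x}"
  unfolding bounded_iff
proof (intro exI ballI)
  fix x assume "x \<in> {x. s < f x}"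
  then have "s < std_normal_density x" using le[of x] by simp
  also have "\<dots> \<le> exp (- x\<^sup>2 / 2)"
    using pi_ge_two unfolding std_normal_density_def by (intro mult_left_le_one_le) auto
  also have "\<dots> \<le> 1 / (1 + x\<^sup>2 / 2)"
  proof -
    have "1 + x\<^sup>2 / 2 \<le> exp (x\<^sup>2 / 2)" by (rule exp_ge_add_one_self)
    moreover have "0 < 1 + x\<^sup>2 / 2" by (smt (verit) zero_le_power2 divide_nonneg_pos)
    ultimately have "inverse (exp (x\<^sup>2 / 2)) \<le> inverse (1 + x\<^sup>2 / 2)" by (rule le_imp_inverse_le)
    then show ?thesis by (simp add: exp_minus inverse_eq_divide)
  qed
  finally have "s * (1 + x\<^sup>2 / 2) < 1"
    by (smt (verit) zero_le_power2 divide_nonneg_pos pos_less_divide_eq)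
  then have "x\<^sup>2 < 2 / s" using s by (simp add: field_simps)
  then show "norm x \<le> sqrt (2 / s)" using real_le_rsqrt[of "\<bar>x\<bar>"] by simp
qed

text \<open>Stated on all sequences, so that convex combinations and updates of a coordinate stay in
  the domain without any restriction to \<open>{..<n}\<close>.\<close>

definition log_concave_seq :: "((nat \<Rightarrow> real) \<Rightarrow> real) \<Rightarrow> bool" where
  "log_concave_seq F \<longleftrightarrow> (\<forall>x. 0 \<le> F x) \<and> (\<forall>x y t. 0 < t \<longrightarrow> t < 1 \<longrightarrow>
     F x powr (1 - t) * F y powr t \<le> F (\<lambda>i. (1 - t) * x i + t * y i))"

lemma log_concave_seqD:
  "log_concave_seq F \<Longrightarrow> 0 < t \<Longrightarrow> t < 1 \<Longrightarrow>
    F x powr (1 - t) * F y powr t \<le> F (\<lambda>i. (1 - t) * x i + t * y i)"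
  by (simp add: log_concave_seq_def)

lemma log_concave_seq_nonneg: "log_concave_seq F \<Longrightarrow> 0 \<le> F x"
  by (simp add: log_concave_seq_def)

lemma log_concave_seq_coordinate:
  assumes "log_concave_seq F"
  shows "log_concave (\<lambda>s. F (z(k := s)))"
  unfolding log_concave_def
proof (intro conjI allI impI)
  fix x y t :: real
  assume t: "0 < t" "t < 1"
  have "(\<lambda>i. (1 - t) * (z(k := x)) i + t * (z(k := y)) i) = z(k := (1 - t) * x + t * y)"
    by (auto simp: algebra_simps)
  then show "F (z(k := x)) powr (1 - t) * F (z(k := y)) powr t \<le> F (z(k := (1 - t) * x + t * y))"
    using log_concave_seqD[OF assms t, of "z(k := x)" "z(k := y)"] by simp
qed (rule log_concave_seq_nonneg[OF assms])

lemma measurable_fun_upd_seq [measurable]: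
  "(\<lambda>s. z(k := s)) \<in> borel \<rightarrow>\<^sub>M (\<Pi>\<^sub>M i\<in>UNIV. (borel :: real measure))"
  "(\<lambda>(z, s). z(k := s)) \<in> (\<Pi>\<^sub>M i\<in>UNIV. (borel :: real measure)) \<Otimes>\<^sub>M borel
     \<rightarrow>\<^sub>M (\<Pi>\<^sub>M i\<in>UNIV. (borel :: real measure))"
  unfolding fun_upd_def split_beta' by (intro measurable_abs_UNIV; measurable)+

text \<open>The result remains a function of the whole sequence, constant in coordinate k, so that
  marginals of different coordinates can be iterated.\<close>

definition marginal :: "nat \<Rightarrow> ((nat \<Rightarrow> real) \<Rightarrow> real) \<Rightarrow> (nat \<Rightarrow> real) \<Rightarrow> real" where
  "marginal k F z = (\<integral>s. F (z(k := s)) \<partial>std_normal)"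

context
  fixes F :: "(nat \<Rightarrow> real) \<Rightarrow> real"
  assumes F [measurable]: "F \<in> borel_measurable (\<Pi>\<^sub>M i\<in>UNIV. (borel :: real measure))"
    and F0: "\<And>x. 0 \<le> F x" and F1: "\<And>x. F x \<le> 1"
begin

lemma measurable_marginal: "marginal k F \<in> borel_measurable (\<Pi>\<^sub>M i\<in>UNIV. borel)"
  unfolding marginal_def
  by (rule std_normal.borel_measurable_lebesgue_integral) measurable

lemma marginal_nonneg: "0 \<le> marginal k F z"
  unfolding marginal_def using F0 by (intro integral_nonneg_AE) auto

lemma marginal_le_1: "marginal k F z \<le> 1"
proof -
  have "marginal k F z \<le> (\<integral>s. 1 \<partial>std_normal)"
    unfolding marginal_def
    by (intro integral_mono std_normal_integrable_bounded[where B=1]) (use F0 F1 in auto)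
  then show ?thesis using std_normal.prob_space by simp
qed

text \<open>The density is moved into the integrand, which makes the measure Lebesgue and the level
  sets bounded. Joint log-concavity of F, together with that of the density, is then exactly the
  hypothesis of Prekopa-Leindler along coordinate k.\<close>

lemma log_concave_marginal:
  assumes lc: "log_concave_seq F"
  shows "log_concave_seq (marginal k F)"
  unfolding log_concave_seq_def
proof (intro conjI allI impI)
  fix x y :: "nat \<Rightarrow> real" and t :: real
  assume t: "0 < t" "t < 1"
  let ?z = "\<lambda>i. (1 - t) * x i + t * y i"
  let ?f = "\<lambda>z s. F (z(k := s)) * std_normal_density s"
  have eq: "marginal k F z = (\<integral>s. ?f z s \<partial>lborel)" for z
    unfolding marginal_def by (simp add: integral_std_normal mult.commute)
  have int: "integrable lborel (?f z)" for z
    using std_normal_integrable_bounded[of "\<lambda>s. F (z(k := s))" 1] F0 F1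
    by (simp add: integrable_std_normal_iff mult.commute)
  have lcf: "log_concave (?f z)" for z
    by (intro log_concave_mult log_concave_seq_coordinate lc log_concave_std_normal_density)
  have le: "?f z s \<le> std_normal_density s" for z s
    using F0 F1 by (intro mult_left_le_one_le) auto
  have le1: "?f z s \<le> 1" for z s
    using le[of z s] std_normal_density_le_half[of s] by linarith
  show "marginal k F x powr (1 - t) * marginal k F y powr t \<le> marginal k F ?z"
    unfolding eq
  proof (rule prekopa_leindler_interval[OF int int int _ _ _ le1 le1 _ _ _ _ t])
    fix p q :: real
    have "?f x p powr (1 - t) * ?f y q powr t
        = (F (x(k := p)) powr (1 - t) * F (y(k := q)) powr t)
          * (std_normal_density p powr (1 - t) * std_normal_density q powr t)"
      using F0 by (simp add: powr_mult)
    also have "\<dots> \<le> F (\<lambda>i. (1 - t) * (x(k := p)) i + t * (y(k := q)) i)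
        * std_normal_density ((1 - t) * p + t * q)"
      using F0 by (intro mult_mono log_concave_seqD[OF lc t]
        log_concaveD[OF log_concave_std_normal_density t]) auto
    also have "(\<lambda>i. (1 - t) * (x(k := p)) i + t * (y(k := q)) i) = ?z(k := (1 - t) * p + t * q)"
      by auto
    finally show "?f x p powr (1 - t) * ?f y q powr t \<le> ?f ?z ((1 - t) * p + t * q)" .
  qed (use F0 log_concave_superlevel_convex[OF lcf less_imp_le] bounded_superlevel_std_normal_density[OF _ le] in auto)
qed (rule marginal_nonneg)

end

text \<open>Coordinates 0, ..., k - 1 are integrated out; coordinate k is the first one still
  free.\<close>

fun marginals :: "nat \<Rightarrow> ((nat \<Rightarrow> real) \<Rightarrow> real) \<Rightarrow> (nat \<Rightarrow> real) \<Rightarrow> real" where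
  "marginals 0 F = F"
| "marginals (Suc k) F = marginal k (marginals k F)"

lemma marginals_properties:
  assumes "F \<in> borel_measurable (\<Pi>\<^sub>M i\<in>UNIV. (borel :: real measure))" "\<And>x. 0 \<le> F x" "\<And>x. F x \<le> 1"
  shows "marginals k F \<in> borel_measurable (\<Pi>\<^sub>M i\<in>UNIV. borel)
    \<and> (\<forall>z. 0 \<le> marginals k F z \<and> marginals k F z \<le> 1)"
  using assms by (induction k) (auto intro: measurable_marginal marginal_nonneg marginal_le_1)

lemma log_concave_marginals:
  assumes "F \<in> borel_measurable (\<Pi>\<^sub>M i\<in>UNIV. (borel :: real measure))"
    "\<And>x. F x \<le> 1" "log_concave_seq F"
  shows "log_concave_seq (marginals k F)"
proof (induction k)
  case (Suc k)
  then show ?case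
    using marginals_properties[OF assms(1) log_concave_seq_nonneg[OF assms(3)] assms(2), of k]
    by (auto intro: log_concave_marginal)
qed (use assms in simp)

section \<open>Iterated marginals as integrals over the product measure\<close>

abbreviation gauss_measure :: "nat \<Rightarrow> (nat \<Rightarrow> real) measure" where
  "gauss_measure k \<equiv> \<Pi>\<^sub>M i\<in>{..<k}. std_normal"

lemma prob_space_gauss_measure: "prob_space (gauss_measure k)"
  by (intro prob_space_PiM std_normal.prob_space_axioms)

text \<open>Points of \<open>gauss_measure k\<close> are \<open>undefined\<close> from index k on; z
  supplies the free coordinates that a function on sequences needs.\<close>

definition override_below :: "nat \<Rightarrow> (nat \<Rightarrow> real) \<Rightarrow> (nat \<Rightarrow> real) \<Rightarrow> nat \<Rightarrow> real" where
  "override_below k y z = (\<lambda>i. if i < k then y i else z i)"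

lemma measurable_override_below:
  "(\<lambda>y. override_below k y z) \<in> gauss_measure k \<rightarrow>\<^sub>M (\<Pi>\<^sub>M i\<in>UNIV. borel)"
  unfolding override_below_def
proof (intro measurable_abs_UNIV)
  fix i show "(\<lambda>y. if i < k then y i else z i) \<in> gauss_measure k \<rightarrow>\<^sub>M borel"
    by (cases "i < k") (simp_all add: measurable_component_singleton[of _ _ "\<lambda>_. std_normal", simplified])
qed

lemma integral_gauss_measure_Suc:
  fixes g :: "(nat \<Rightarrow> real) \<Rightarrow> real"
  assumes "integrable (gauss_measure (Suc k)) g"
  shows "(\<integral>x. g x \<partial>gauss_measure (Suc k)) = (\<integral>s. (\<integral>y. g (y(k := s)) \<partial>gauss_measure k) \<partial>std_normal)"
proof -
  interpret G: prob_space "gauss_measure k" by (rule prob_space_gauss_measure)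
  interpret P: pair_sigma_finite std_normal "gauss_measure k" ..
  let ?u = "\<lambda>(s :: real, y :: nat \<Rightarrow> real). y(k := s)"
  have eq: "distr (std_normal \<Otimes>\<^sub>M gauss_measure k) (gauss_measure (Suc k)) ?u = gauss_measure (Suc k)"
    using distr_pair_PiM_eq_PiM[of "{..<k}" "\<lambda>_. std_normal" k] std_normal.prob_space_axioms
    by (simp add: lessThan_Suc)
  have m: "?u \<in> std_normal \<Otimes>\<^sub>M gauss_measure k \<rightarrow>\<^sub>M gauss_measure (Suc k)"
    by (simp add: lessThan_Suc)
  have int: "integrable (std_normal \<Otimes>\<^sub>M gauss_measure k) (\<lambda>p. g (?u p))"
    using assms m by (intro integrable_distr[OF m]) (simp add: eq)
  have "(\<integral>x. g x \<partial>gauss_measure (Suc k)) = (\<integral>p. g (?u p) \<partial>(std_normal \<Otimes>\<^sub>M gauss_measure k))"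
    using assms by (subst eq[symmetric], intro integral_distr m) auto
  also have "\<dots> = (\<integral>s. (\<integral>y. g (y(k := s)) \<partial>gauss_measure k) \<partial>std_normal)"
    using P.integral_fst'[OF int] by simp
  finally show ?thesis .
qed

text \<open>Fubini, with z varying in the induction: the coordinate that is split off moves from the
  integration variable into z.\<close>

lemma marginals_eq_integral:
  assumes F: "F \<in> borel_measurable (\<Pi>\<^sub>M i\<in>UNIV. (borel :: real measure))"
    and F0: "\<And>x. 0 \<le> F x" and F1: "\<And>x. F x \<le> 1"
  shows "marginals k F z = (\<integral>y. F (override_below k y z) \<partial>gauss_measure k)"
proof (induction k arbitrary: z)
  case 0
  interpret prob_space "gauss_measure 0" by (rule prob_space_gauss_measure)
  have "override_below 0 y z = z" for y by (simp add: override_below_def)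
  then show ?case using prob_space by simp
next
  case (Suc k)
  interpret prob_space "gauss_measure (Suc k)" by (rule prob_space_gauss_measure)
  have "integrable (gauss_measure (Suc k)) (\<lambda>y. F (override_below (Suc k) y z))"
    by (rule integrable_const_bound[where B=1])
       (use F0 F1 measurable_compose[OF measurable_override_below F] in auto)
  then have "(\<integral>y. F (override_below (Suc k) y z) \<partial>gauss_measure (Suc k))
      = (\<integral>s. (\<integral>y. F (override_below (Suc k) (y(k := s)) z) \<partial>gauss_measure k) \<partial>std_normal)"
    by (rule integral_gauss_measure_Suc)
  also have "\<dots> = (\<integral>s. (\<integral>y. F (override_below k y (z(k := s))) \<partial>gauss_measure k) \<partial>std_normal)"
  proof -
    have "override_below (Suc k) (y(k := s)) z = override_below k y (z(k := s))" for y s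
      by (auto simp: override_below_def less_Suc_eq)
    then show ?thesis by (simp only:)
  qed
  also have "\<dots> = marginals (Suc k) F z" by (simp add: marginal_def Suc.IH del: fun_upd_apply)
  finally show ?case by simp
qed

section \<open>Rotation invariance\<close>

definition gauss_density :: "nat \<Rightarrow> (nat \<Rightarrow> real) \<Rightarrow> real" where
  "gauss_density n x = (2 * pi) powr (- real n / 2) * exp (- (L2_set x {..<n})\<^sup>2 / 2)"

lemma gauss_density_eq_prod: "gauss_density n x = (\<Prod>i<n. std_normal_density (x i))"
proof -
  have "(\<Prod>i<n. std_normal_density (x i)) = (1 / sqrt (2 * pi)) ^ n * (\<Prod>i<n. exp (- (x i)\<^sup>2 / 2))"
    unfolding std_normal_density_def by (simp only: prod.distrib prod_constant card_lessThan)
  also have "(\<Prod>i<n. exp (- (x i)\<^sup>2 / 2)) = exp (- (L2_set x {..<n})\<^sup>2 / 2)"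
    by (simp add: exp_sum[symmetric] L2_set_def sum_nonneg sum_negf sum_divide_distrib)
  also have "(1 / sqrt (2 * pi)) ^ n = (2 * pi) powr (- real n / 2)"
  proof -
    have "1 / sqrt (2 * pi) = (2 * pi) powr (- 1 / 2)"
      by (simp add: powr_minus_divide powr_half_sqrt)
    then have "(1 / sqrt (2 * pi)) ^ n = ((2 * pi) powr (- 1 / 2)) powr real n"
      by (simp add: powr_realpow)
    then show ?thesis by (simp add: powr_powr)
  qed
  finally show ?thesis by (simp add: gauss_density_def)
qed

lemma gauss_density_nonneg: "0 \<le> gauss_density n x"
  by (simp add: gauss_density_def)

lemma sets_gauss_measure: "sets (gauss_measure n) = sets (Rn_lebesgue n)"
  unfolding Rn_lebesgue_def by (intro sets_PiM_cong) auto

lemma space_gauss_measure: "space (gauss_measure n) = Rn n"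
  by (simp add: space_PiM Rn_def)

lemma measurable_Rn_component [measurable]:
  "i < n \<Longrightarrow> (\<lambda>x. x i) \<in> borel_measurable (Rn_lebesgue n)"
  unfolding Rn_lebesgue_def using measurable_component_singleton[of i "{..<n}" "\<lambda>_. lborel"] by simp

lemma measurable_into_Rn:
  assumes "\<And>i. i < n \<Longrightarrow> (\<lambda>x. f x i) \<in> borel_measurable N"
  shows "(\<lambda>x. \<lambda>i\<in>{..<n}. f x i) \<in> N \<rightarrow>\<^sub>M Rn_lebesgue n"
  unfolding Rn_lebesgue_def by (intro measurable_restrict) (use assms in auto)

lemma measurable_gauss_density [measurable]: "gauss_density n \<in> borel_measurable (Rn_lebesgue n)"
  unfolding gauss_density_eq_prod[abs_def]
  by (intro borel_measurable_prod measurable_compose[OF measurable_Rn_component borel_measurable_normal_density])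
     simp

interpretation lborel_prod: product_sigma_finite "\<lambda>_::nat. lborel :: real measure" ..

text \<open>\<open>gauss\<close> and \<open>barycenter\<close> integrate a density against
  \<open>Rn_lebesgue\<close>, while Fubini for marginals uses the product form; agreement on boxes
  links the two.\<close>

lemma gauss_measure_eq_density:
  "gauss_measure n = density (Rn_lebesgue n) (\<lambda>x. ennreal (gauss_density n x))"
proof -
  interpret product_sigma_finite "\<lambda>_::nat. std_normal" ..
  have "density (Rn_lebesgue n) (\<lambda>x. ennreal (gauss_density n x)) = gauss_measure n"
  proof (rule PiM_eqI)
    fix A :: "nat \<Rightarrow> real set" assume "\<And>i. i \<in> {..<n} \<Longrightarrow> A i \<in> sets std_normal"
    then have A [measurable]: "A i \<in> sets borel" if "i < n" for i using that by auto
    have box: "Pi\<^sub>E {..<n} A \<in> sets (Rn_lebesgue n)"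
      unfolding Rn_lebesgue_def using A by (intro sets_PiM_I_finite) auto
    have "emeasure (density (Rn_lebesgue n) (\<lambda>x. ennreal (gauss_density n x))) (Pi\<^sub>E {..<n} A)
        = (\<integral>\<^sup>+x. ennreal (gauss_density n x) * indicator (Pi\<^sub>E {..<n} A) x \<partial>Rn_lebesgue n)"
      using box by (intro emeasure_density) auto
    also have "\<dots> = (\<integral>\<^sup>+x. (\<Prod>i<n. ennreal (std_normal_density (x i)) * indicator (A i) (x i)) \<partial>Rn_lebesgue n)"
    proof (intro nn_integral_cong)
      fix x assume "x \<in> space (Rn_lebesgue n)"
      then have "x \<in> extensional {..<n}" by (auto simp: space_Rn_lebesgue Rn_def PiE_def)
      then have "indicator (Pi\<^sub>E {..<n} A) x = (\<Prod>i<n. indicator (A i) (x i) :: ennreal)"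
        by (auto simp: indicator_def PiE_def Pi_def)
      then show "ennreal (gauss_density n x) * indicator (Pi\<^sub>E {..<n} A) x
          = (\<Prod>i<n. ennreal (std_normal_density (x i)) * indicator (A i) (x i))"
        by (simp add: gauss_density_eq_prod prod_ennreal[symmetric] prod.distrib)
    qed
    also have "\<dots> = (\<Prod>i<n. \<integral>\<^sup>+x. ennreal (std_normal_density x) * indicator (A i) x \<partial>lborel)"
      unfolding Rn_lebesgue_def using A by (intro lborel_prod.product_nn_integral_prod) auto
    also have "\<dots> = (\<Prod>i<n. emeasure std_normal (A i))"
      using A by (intro prod.cong refl) (simp add: std_normal_def emeasure_density)
    finally show "emeasure (density (Rn_lebesgue n) (\<lambda>x. ennreal (gauss_density n x))) (Pi\<^sub>E {..<n} A)
        = (\<Prod>i<n. emeasure std_normal (A i))" .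
  qed (simp_all add: sets_gauss_measure)
  then show ?thesis by simp
qed

lemma set_integral_gauss:
  fixes g :: "(nat \<Rightarrow> real) \<Rightarrow> real"
  assumes [measurable]: "g \<in> borel_measurable (Rn_lebesgue n)" "A \<in> sets (Rn_lebesgue n)"
  shows "(2 * pi) powr (- real n / 2) * (LINT x:A|Rn_lebesgue n. g x * exp (- (L2_set x {..<n})\<^sup>2 / 2))
    = (\<integral>x. indicator A x * g x \<partial>gauss_measure n)"
proof -
  have "(\<integral>x. indicator A x * g x \<partial>gauss_measure n)
      = (\<integral>x. gauss_density n x * (indicator A x * g x) \<partial>Rn_lebesgue n)"
    unfolding gauss_measure_eq_density by (subst integral_density) (auto simp: gauss_density_nonneg)
  then show ?thesis
    unfolding set_lebesgue_integral_def integral_mult_right_zero[symmetric]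
    by (simp add: gauss_density_def ac_simps)
qed

lemma gauss_eq_integral:
  assumes "A \<in> sets (Rn_lebesgue n)"
  shows "gauss n A = (\<integral>x. indicator A x \<partial>gauss_measure n)"
  using set_integral_gauss[of "\<lambda>_. 1" n A] assms by (simp add: gauss_def)

section \<open>Invariance under translations and isometries\<close>

definition translate :: "nat \<Rightarrow> (nat \<Rightarrow> real) \<Rightarrow> (nat \<Rightarrow> real) \<Rightarrow> nat \<Rightarrow> real" where
  "translate n c x = (\<lambda>i\<in>{..<n}. x i + c i)"

lemma measurable_translate [measurable]:
  "translate n c \<in> Rn_lebesgue n \<rightarrow>\<^sub>M Rn_lebesgue n"
  unfolding translate_def[abs_def] by (intro measurable_into_Rn) measurable

lemma distr_translate: "distr (Rn_lebesgue n) (Rn_lebesgue n) (translate n c) = Rn_lebesgue n"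
proof -
  have "distr (Rn_lebesgue n) (Rn_lebesgue n) (translate n c) = (\<Pi>\<^sub>M i\<in>{..<n}. lborel)"
  proof (rule lborel_prod.PiM_eqI)
    fix A :: "nat \<Rightarrow> real set" assume "\<And>i. i \<in> {..<n} \<Longrightarrow> A i \<in> sets lborel"
    then have A [measurable]: "A i \<in> sets borel" if "i < n" for i using that by auto
    have box: "Pi\<^sub>E {..<n} A \<in> sets (Rn_lebesgue n)"
      unfolding Rn_lebesgue_def using A by (intro sets_PiM_I_finite) auto
    have pre: "(\<lambda>x. x + c i) -` A i \<in> sets borel" if "i < n" for i
      by (rule measurable_sets_borel[OF _ A[OF that]]) simp
    have "emeasure (distr (Rn_lebesgue n) (Rn_lebesgue n) (translate n c)) (Pi\<^sub>E {..<n} A)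
        = emeasure (Rn_lebesgue n) (translate n c -` Pi\<^sub>E {..<n} A \<inter> space (Rn_lebesgue n))"
      using box by (intro emeasure_distr) auto
    also have "translate n c -` Pi\<^sub>E {..<n} A \<inter> space (Rn_lebesgue n)
        = Pi\<^sub>E {..<n} (\<lambda>i. (\<lambda>x. x + c i) -` A i)"
      by (auto simp: translate_def space_Rn_lebesgue Rn_def PiE_iff)
    also have "emeasure (Rn_lebesgue n) \<dots> = (\<Prod>i<n. emeasure lborel ((\<lambda>x. x + c i) -` A i))"
      unfolding Rn_lebesgue_def using pre by (intro lborel_prod.emeasure_PiM) auto
    also have "\<dots> = (\<Prod>i<n. emeasure lborel (A i))"
    proof (intro prod.cong refl)
      fix i assume "i \<in> {..<n}"
      then have [measurable]: "A i \<in> sets borel" by simp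
      have "(\<lambda>x. x + c i) = (+) (c i)" by auto
      then have "emeasure lborel (A i) = emeasure (distr lborel borel (\<lambda>x. x + c i)) (A i)"
        by (simp add: lborel_distr_plus)
      also have "\<dots> = emeasure lborel ((\<lambda>x. x + c i) -` A i)"
        by (subst emeasure_distr) auto
      finally show "emeasure lborel ((\<lambda>x. x + c i) -` A i) = emeasure lborel (A i)" by simp
    qed
    finally show "emeasure (distr (Rn_lebesgue n) (Rn_lebesgue n) (translate n c)) (Pi\<^sub>E {..<n} A)
        = (\<Prod>i\<in>{..<n}. emeasure lborel (A i))" .
  qed (simp_all add: Rn_lebesgue_def)
  then show ?thesis by (simp add: Rn_lebesgue_def)
qed

lemma nn_integral_translate:
  assumes [measurable]: "f \<in> borel_measurable (Rn_lebesgue n)"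
  shows "(\<integral>\<^sup>+x. f (translate n c x) \<partial>Rn_lebesgue n) = (\<integral>\<^sup>+x. f x \<partial>Rn_lebesgue n)"
  using nn_integral_distr[of "translate n c" "Rn_lebesgue n" "Rn_lebesgue n" f]
  by (simp add: distr_translate)

lemma sigma_finite_Rn_lebesgue: "sigma_finite_measure (Rn_lebesgue n)"
  unfolding Rn_lebesgue_def by (intro lborel_prod.sigma_finite) simp

text \<open>
  Uniqueness of Haar measure in disguise: the double integral of \<open>f (T x) * G (y + T x)\<close>, where
  \<open>G\<close> is the Gaussian density, is evaluated in both orders.
\<close>

lemma nn_integral_isometry_reflect:
  assumes f [measurable]: "f \<in> borel_measurable (Rn_lebesgue n)"
    and T [measurable]: "T \<in> Rn_lebesgue n \<rightarrow>\<^sub>M Rn_lebesgue n"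
    and TS: "\<And>x y. x \<in> Rn n \<Longrightarrow> y \<in> Rn n \<Longrightarrow>
      T (translate n (\<lambda>i. - S y i) x) = translate n (\<lambda>i. - y i) (T x)"
    and norm: "\<And>x. x \<in> Rn n \<Longrightarrow> gauss_density n (T x) = gauss_density n x"
  shows "(\<integral>\<^sup>+x. f (T x) \<partial>Rn_lebesgue n) = (\<integral>\<^sup>+y. f (\<lambda>i\<in>{..<n}. - y i) \<partial>Rn_lebesgue n)"
proof -
  let ?M = "Rn_lebesgue n"
  interpret sigma_finite_measure ?M by (rule sigma_finite_Rn_lebesgue)
  interpret P: pair_sigma_finite ?M ?M ..
  define G where "G x = ennreal (gauss_density n x)" for x
  have [measurable]: "G \<in> borel_measurable ?M" unfolding G_def by measurable
  have T_Rn: "T x \<in> Rn n" if "x \<in> Rn n" for x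
    using measurable_space[OF T] that by (simp add: space_Rn_lebesgue)
  have int_G: "(\<integral>\<^sup>+y. G y \<partial>?M) = 1"
  proof -
    interpret prob_space "gauss_measure n" by (rule prob_space_gauss_measure)
    have "1 = emeasure (gauss_measure n) (space ?M)"
      using emeasure_space_1 by (simp add: space_gauss_measure space_Rn_lebesgue)
    also have "\<dots> = (\<integral>\<^sup>+y. G y * indicator (space ?M) y \<partial>?M)"
      unfolding gauss_measure_eq_density G_def by (intro emeasure_density) auto
    also have "\<dots> = (\<integral>\<^sup>+y. G y \<partial>?M)" by (intro nn_integral_cong) simp
    finally show ?thesis by simp
  qed
  have comp: "(\<lambda>p. T (fst p) i) \<in> borel_measurable (?M \<Otimes>\<^sub>M ?M)"
    "(\<lambda>p. snd p i) \<in> borel_measurable (?M \<Otimes>\<^sub>M ?M)" if "i < n" for i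
    by (rule measurable_compose[OF measurable_compose[OF measurable_fst T] measurable_Rn_component[OF that]]
      measurable_compose[OF measurable_snd measurable_Rn_component[OF that]])+
  have neg [measurable]: "(\<lambda>y. \<lambda>i\<in>{..<n}. - y i) \<in> ?M \<rightarrow>\<^sub>M ?M"
    by (intro measurable_into_Rn) measurable
  have tr_neg [measurable]: "(\<lambda>p. translate n (\<lambda>i. - snd p i) (T (fst p))) \<in> ?M \<Otimes>\<^sub>M ?M \<rightarrow>\<^sub>M ?M"
    unfolding translate_def
    by (intro measurable_into_Rn borel_measurable_add borel_measurable_uminus comp)
  have tr_T [measurable]: "(\<lambda>p. translate n (T (fst p)) (snd p)) \<in> ?M \<Otimes>\<^sub>M ?M \<rightarrow>\<^sub>M ?M"
    unfolding translate_def
    by (intro measurable_into_Rn borel_measurable_add comp)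
  \<comment> \<open>G has integral 1, also after a translation by T x.\<close>
  have "(\<integral>\<^sup>+x. f (T x) \<partial>?M) = (\<integral>\<^sup>+x. f (T x) * (\<integral>\<^sup>+y. G y \<partial>?M) \<partial>?M)" by (simp add: int_G)
  also have "\<dots> = (\<integral>\<^sup>+x. \<integral>\<^sup>+y. f (T x) * G (translate n (T x) y) \<partial>?M \<partial>?M)"
    by (intro nn_integral_cong) (simp add: nn_integral_cmult nn_integral_translate)
  also have "\<dots> = (\<integral>\<^sup>+y. \<integral>\<^sup>+x. f (T x) * G (translate n (T x) y) \<partial>?M \<partial>?M)"
    by (rule P.Fubini'[symmetric]) (simp add: split_beta')
  also have "\<dots> = (\<integral>\<^sup>+y. \<integral>\<^sup>+x. f (translate n (\<lambda>i. - y i) (T x)) * G (T x) \<partial>?M \<partial>?M)"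
  proof (rule nn_integral_cong)
    fix y assume y: "y \<in> space ?M"
    let ?g = "\<lambda>x. f (T x) * G (translate n (T x) y)"
    have [measurable]: "(\<lambda>x. translate n (T x) y) \<in> ?M \<rightarrow>\<^sub>M ?M"
      unfolding translate_def
      by (intro measurable_into_Rn borel_measurable_add
        measurable_compose[OF T measurable_Rn_component]) auto
    \<comment> \<open>S acts as an inverse of T: translating x by - S y turns T x into T x - y,
      which cancels the shift inside G.\<close>
    have "(\<integral>\<^sup>+x. ?g x \<partial>?M) = (\<integral>\<^sup>+x. ?g (translate n (\<lambda>i. - S y i) x) \<partial>?M)"
      by (rule nn_integral_translate[symmetric]) measurable
    also have "\<dots> = (\<integral>\<^sup>+x. f (translate n (\<lambda>i. - y i) (T x)) * G (T x) \<partial>?M)"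
    proof (rule nn_integral_cong)
      fix x assume "x \<in> space ?M"
      then have x: "x \<in> Rn n" and "y \<in> Rn n" using y by (auto simp: space_Rn_lebesgue)
      then have eq: "T (translate n (\<lambda>i. - S y i) x) = translate n (\<lambda>i. - y i) (T x)" by (rule TS)
      have "translate n (translate n (\<lambda>i. - y i) (T x)) y = T x"
        using T_Rn[OF x] by (auto simp: translate_def Rn_def PiE_def extensional_def)
      then show "?g (translate n (\<lambda>i. - S y i) x) = f (translate n (\<lambda>i. - y i) (T x)) * G (T x)"
        by (simp add: eq)
    qed
    finally show "(\<integral>\<^sup>+x. ?g x \<partial>?M) = (\<integral>\<^sup>+x. f (translate n (\<lambda>i. - y i) (T x)) * G (T x) \<partial>?M)" .
  qed
  also have "\<dots> = (\<integral>\<^sup>+x. \<integral>\<^sup>+y. f (translate n (\<lambda>i. - y i) (T x)) * G (T x) \<partial>?M \<partial>?M)"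
    by (rule P.Fubini') (simp add: split_beta')
  also have "\<dots> = (\<integral>\<^sup>+x. (\<integral>\<^sup>+y. f (\<lambda>i\<in>{..<n}. - y i) \<partial>?M) * G x \<partial>?M)"
  proof (rule nn_integral_cong)
    fix x assume "x \<in> space ?M"
    then have x: "x \<in> Rn n" by (simp add: space_Rn_lebesgue)
    let ?h = "\<lambda>y. f (translate n (\<lambda>i. - y i) (T x))"
    have [measurable]: "(\<lambda>y. translate n (\<lambda>i. - y i) (T x)) \<in> ?M \<rightarrow>\<^sub>M ?M"
      unfolding translate_def
      by (intro measurable_into_Rn borel_measurable_add borel_measurable_uminus measurable_Rn_component) auto
    have "(\<integral>\<^sup>+y. ?h y * G (T x) \<partial>?M) = (\<integral>\<^sup>+y. ?h y \<partial>?M) * G (T x)"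
      by (rule nn_integral_multc) measurable
    \<comment> \<open>Translating y by T x leaves - y in the argument of f, which no longer depends
      on x.\<close>
    also have "(\<integral>\<^sup>+y. ?h y \<partial>?M) = (\<integral>\<^sup>+y. ?h (translate n (T x) y) \<partial>?M)"
      by (rule nn_integral_translate[symmetric]) measurable
    also have "\<dots> = (\<integral>\<^sup>+y. f (\<lambda>i\<in>{..<n}. - y i) \<partial>?M)"
    proof (rule nn_integral_cong)
      fix y
      have "translate n (\<lambda>i. - translate n (T x) y i) (T x) = (\<lambda>i\<in>{..<n}. - y i)"
        by (auto simp: translate_def)
      then show "?h (translate n (T x) y) = f (\<lambda>i\<in>{..<n}. - y i)" by simp
    qed
    finally show "(\<integral>\<^sup>+y. ?h y * G (T x) \<partial>?M) = (\<integral>\<^sup>+y. f (\<lambda>i\<in>{..<n}. - y i) \<partial>?M) * G x"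
      by (simp add: G_def norm[OF x])
  qed
  also have "\<dots> = (\<integral>\<^sup>+y. f (\<lambda>i\<in>{..<n}. - y i) \<partial>?M)" by (simp add: nn_integral_cmult int_G)
  finally show ?thesis .
qed

text \<open>\<open>nn_integral_isometry_reflect\<close> has the same right-hand side for T and for
  the identity, so the reflection cancels; the Gaussian density itself is unchanged by T.\<close>

lemma distr_gauss_measure_isometry:
  assumes T [measurable]: "T \<in> Rn_lebesgue n \<rightarrow>\<^sub>M Rn_lebesgue n"
    and TS: "\<And>x y. x \<in> Rn n \<Longrightarrow> y \<in> Rn n \<Longrightarrow>
      T (translate n (\<lambda>i. - S y i) x) = translate n (\<lambda>i. - y i) (T x)"
    and norm: "\<And>x. x \<in> Rn n \<Longrightarrow> gauss_density n (T x) = gauss_density n x"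
  shows "distr (gauss_measure n) (gauss_measure n) T = gauss_measure n"
proof (rule measure_eqI)
  have T' [measurable]: "T \<in> gauss_measure n \<rightarrow>\<^sub>M gauss_measure n"
    using T by (simp cong: measurable_cong_sets add: sets_gauss_measure)
  fix A assume "A \<in> sets (distr (gauss_measure n) (gauss_measure n) T)"
  then have A: "A \<in> sets (gauss_measure n)" and A' [measurable]: "A \<in> sets (Rn_lebesgue n)"
    by (simp_all add: sets_gauss_measure)
  let ?f = "\<lambda>x. ennreal (gauss_density n x) * indicator A x"
  have pre: "T -` A \<inter> space (Rn_lebesgue n) \<in> sets (Rn_lebesgue n)" by measurable
  have "emeasure (distr (gauss_measure n) (gauss_measure n) T) A
      = emeasure (gauss_measure n) (T -` A \<inter> space (Rn_lebesgue n))"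
    using A by (simp add: emeasure_distr space_gauss_measure space_Rn_lebesgue)
  also have "\<dots> = (\<integral>\<^sup>+x. ennreal (gauss_density n x)
      * indicator (T -` A \<inter> space (Rn_lebesgue n)) x \<partial>Rn_lebesgue n)"
    unfolding gauss_measure_eq_density by (rule emeasure_density[OF _ pre]) measurable
  also have "\<dots> = (\<integral>\<^sup>+x. ?f (T x) \<partial>Rn_lebesgue n)"
    by (rule nn_integral_cong) (auto simp: norm space_Rn_lebesgue indicator_def)
  also have "\<dots> = (\<integral>\<^sup>+y. ?f (\<lambda>i\<in>{..<n}. - y i) \<partial>Rn_lebesgue n)"
    by (rule nn_integral_isometry_reflect[OF _ T TS norm]) measurable
  also have "\<dots> = (\<integral>\<^sup>+x. ?f x \<partial>Rn_lebesgue n)"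
    by (rule nn_integral_isometry_reflect[where T="\<lambda>x. x" and S="\<lambda>x. x", symmetric]) measurable
  also have "\<dots> = emeasure (gauss_measure n) A"
    unfolding gauss_measure_eq_density by (rule emeasure_density[symmetric]) measurable
  finally show "emeasure (distr (gauss_measure n) (gauss_measure n) T) A = emeasure (gauss_measure n) A" .
qed simp

section \<open>Orthonormal frames as isometries\<close>

definition orthonormal_frame :: "nat \<Rightarrow> (nat \<Rightarrow> nat \<Rightarrow> real) \<Rightarrow> bool" where
  "orthonormal_frame n U \<longleftrightarrow> (\<forall>j<n. \<forall>k<n. dot n (U j) (U k) = (if j = k then 1 else 0))"

definition frame_map :: "nat \<Rightarrow> (nat \<Rightarrow> nat \<Rightarrow> real) \<Rightarrow> (nat \<Rightarrow> real) \<Rightarrow> nat \<Rightarrow> real" where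
  "frame_map n U x = (\<lambda>i\<in>{..<n}. \<Sum>j<n. x j * U j i)"

lemma frame_map_dot:
  assumes U: "orthonormal_frame n U" and k: "k < n"
  shows "dot n (frame_map n U x) (U k) = x k"
proof -
  have "dot n (frame_map n U x) (U k) = (\<Sum>i<n. \<Sum>j<n. x j * (U j i * U k i))"
    by (simp add: dot_def frame_map_def sum_distrib_right mult.assoc)
  also have "\<dots> = (\<Sum>j<n. x j * dot n (U j) (U k))"
    unfolding dot_def sum_distrib_left by (rule sum.swap)
  also have "\<dots> = (\<Sum>j<n. if j = k then x j else 0)"
    using U k by (intro sum.cong) (auto simp: orthonormal_frame_def)
  also have "\<dots> = x k" using k by simp
  finally show ?thesis .
qed

lemma frame_map_norm_sq:
  assumes U: "orthonormal_frame n U"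
  shows "(\<Sum>i<n. (frame_map n U x i)\<^sup>2) = (\<Sum>j<n. (x j)\<^sup>2)"
proof -
  have "(\<Sum>i<n. (frame_map n U x i)\<^sup>2) = (\<Sum>i<n. \<Sum>j<n. x j * (frame_map n U x i * U j i))"
    by (intro sum.cong refl)
       (simp add: frame_map_def power2_eq_square sum_distrib_left mult.assoc mult.left_commute)
  also have "\<dots> = (\<Sum>j<n. x j * dot n (frame_map n U x) (U j))"
    unfolding dot_def sum_distrib_left by (rule sum.swap)
  also have "\<dots> = (\<Sum>j<n. (x j)\<^sup>2)"
    using U by (intro sum.cong refl) (simp add: frame_map_dot power2_eq_square)
  finally show ?thesis .
qed

text \<open>
  The standard unit vectors lose \<open>n - n = 0\<close> in total when projected to the span of the frame,
  hence by Bessel's inequality none of them loses anything.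
\<close>

lemma orthonormal_frame_complete:
  assumes U: "orthonormal_frame n U" and "i < n" "k < n"
  shows "(\<Sum>j<n. U j i * U j k) = (if i = k then 1 else 0)"
proof -
  define e where "e i k = (if i = k then 1 else 0 :: real)" for i k :: nat
  define c where "c i = (\<Sum>j<n. (U j i)\<^sup>2)" for i
  have defect: "(\<Sum>k<n. (e i k - frame_map n U (\<lambda>j. U j i) k)\<^sup>2) = 1 - c i" if i: "i < n" for i
  proof -
    have "(\<Sum>k<n. (e i k - frame_map n U (\<lambda>j. U j i) k)\<^sup>2)
        = (\<Sum>k<n. (e i k)\<^sup>2) - 2 * (\<Sum>k<n. e i k * frame_map n U (\<lambda>j. U j i) k)
          + (\<Sum>k<n. (frame_map n U (\<lambda>j. U j i) k)\<^sup>2)"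
      by (simp add: power2_diff sum.distrib sum_subtractf sum_distrib_left mult.assoc)
    also have "(\<Sum>k<n. (e i k)\<^sup>2) = (\<Sum>k<n. if i = k then 1 else 0)"
      by (intro sum.cong) (auto simp: e_def)
    also have "(\<Sum>k<n. if i = k then 1 else 0 :: real) = 1" using i by simp
    also have "(\<Sum>k<n. e i k * frame_map n U (\<lambda>j. U j i) k)
        = (\<Sum>k<n. if i = k then frame_map n U (\<lambda>j. U j i) k else 0)"
      by (intro sum.cong) (auto simp: e_def)
    also have "\<dots> = frame_map n U (\<lambda>j. U j i) i" using i by simp
    also have "\<dots> = c i" using i by (simp add: frame_map_def c_def power2_eq_square)
    also have "(\<Sum>k<n. (frame_map n U (\<lambda>j. U j i) k)\<^sup>2) = c i"
      using frame_map_norm_sq[OF U] by (simp add: c_def)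
    finally show ?thesis by simp
  qed
  have "(\<Sum>i<n. 1 - c i) = 0"
  proof -
    have "(\<Sum>i<n. c i) = (\<Sum>j<n. dot n (U j) (U j))"
      unfolding c_def dot_def power2_eq_square by (rule sum.swap)
    also have "\<dots> = real n" using U by (simp add: orthonormal_frame_def)
    finally show ?thesis by (simp add: sum_subtractf)
  qed
  moreover have "0 \<le> 1 - c i" if "i < n" for i
    unfolding defect[OF that, symmetric] by (intro sum_nonneg) simp
  ultimately have "1 - c i = 0" using \<open>i < n\<close> by (subst (asm) sum_nonneg_eq_0_iff) auto
  then have "(\<Sum>k<n. (e i k - frame_map n U (\<lambda>j. U j i) k)\<^sup>2) = 0" using defect[OF \<open>i < n\<close>] by simp
  then have "(e i k - frame_map n U (\<lambda>j. U j i) k)\<^sup>2 = 0"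
    using \<open>k < n\<close> by (subst (asm) sum_nonneg_eq_0_iff) auto
  then show ?thesis using \<open>k < n\<close> by (simp add: e_def frame_map_def split: if_splits)
qed

lemma measurable_frame_map [measurable]: "frame_map n U \<in> Rn_lebesgue n \<rightarrow>\<^sub>M Rn_lebesgue n"
  unfolding frame_map_def[abs_def]
  by (intro measurable_into_Rn borel_measurable_sum borel_measurable_times measurable_Rn_component) auto

text \<open>The inverse map takes y to its coefficients \<open>dot n y (U j)\<close>. That these
  reproduce y is the completeness of the frame.\<close>

lemma distr_gauss_measure_frame_map:
  assumes U: "orthonormal_frame n U"
  shows "distr (gauss_measure n) (gauss_measure n) (frame_map n U) = gauss_measure n"
proof (rule distr_gauss_measure_isometry[where S="\<lambda>y j. dot n y (U j)"])
  fix x y assume x: "x \<in> Rn n" and y: "y \<in> Rn n"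
  show "frame_map n U (translate n (\<lambda>i. - dot n y (U i)) x) = translate n (\<lambda>i. - y i) (frame_map n U x)"
  proof
    fix i
    show "frame_map n U (translate n (\<lambda>i. - dot n y (U i)) x) i
        = translate n (\<lambda>i. - y i) (frame_map n U x) i"
    proof (cases "i < n")
      case True
      have "(\<Sum>j<n. dot n y (U j) * U j i) = (\<Sum>k<n. y k * (\<Sum>j<n. U j i * U j k))"
        unfolding dot_def sum_distrib_left sum_distrib_right
        by (subst sum.swap) (simp add: mult_ac)
      also have "\<dots> = (\<Sum>k<n. if i = k then y k else 0)"
        using orthonormal_frame_complete[OF U True] by (intro sum.cong) auto
      also have "\<dots> = y i" using True by simp
      finally show ?thesis
        using True by (simp add: frame_map_def translate_def algebra_simps sum_subtractf)
    qed (simp add: frame_map_def translate_def)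
  qed
next
  fix x
  have "L2_set (frame_map n U x) {..<n} = L2_set x {..<n}"
    unfolding L2_set_def frame_map_norm_sq[OF U] ..
  then show "gauss_density n (frame_map n U x) = gauss_density n x" by (simp add: gauss_density_def)
qed measurable

lemma integral_frame_map:
  fixes g :: "(nat \<Rightarrow> real) \<Rightarrow> real"
  assumes U: "orthonormal_frame n U" and g: "g \<in> borel_measurable (Rn_lebesgue n)"
  shows "(\<integral>x. g (frame_map n U x) \<partial>gauss_measure n) = (\<integral>x. g x \<partial>gauss_measure n)"
proof -
  have "frame_map n U \<in> gauss_measure n \<rightarrow>\<^sub>M gauss_measure n" "g \<in> borel_measurable (gauss_measure n)"
    using measurable_frame_map g by (simp_all cong: measurable_cong_sets add: sets_gauss_measure)
  from integral_distr[OF this] show ?thesis by (simp add: distr_gauss_measure_frame_map[OF U])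
qed

lemma integrable_gauss_measure_component:
  assumes "i < n" shows "integrable (gauss_measure n) (\<lambda>x. x i)"
proof -
  have "distr (gauss_measure n) std_normal (\<lambda>x. x i) = std_normal"
    using assms std_normal.prob_space_axioms by (intro distr_PiM_component) auto
  then have "integrable (distr (gauss_measure n) std_normal (\<lambda>x. x i)) (\<lambda>s. s)" by simp
  then show ?thesis by (rule integrable_distr[rotated]) (use assms in auto)
qed

text \<open>On all real sequences the product sigma-algebra is the Borel one. The preimage of K
  under restriction is closed there, and K is recovered from it by padding points of the
  n-dimensional space with zeros.\<close>

lemma closedin_Rn_measurable:
  assumes "closedin (Rn_topology n) K"
  shows "K \<in> sets (Rn_lebesgue n)"
proof -
  have sub: "K \<subseteq> Rn n" using closedin_subset[OF assms] by (simp add: topspace_Rn_topology)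
  define r where "r z = restrict z {..<n}" for z :: "nat \<Rightarrow> real"
  have "continuous_map (product_topology (\<lambda>_. euclideanreal) UNIV) (Rn_topology n) r"
    unfolding Rn_topology_def r_def continuous_map_componentwise
    by (auto intro: continuous_map_product_projection)
  then have "closedin euclidean (r -` K)"
    using closedin_continuous_map_preimage[OF _ assms]
    by (fastforce simp: euclidean_product_topology vimage_def)
  then have "r -` K \<in> sets borel" unfolding closed_closedin[symmetric] by (rule borel_closed)
  then have closed: "r -` K \<in> sets (\<Pi>\<^sub>M i\<in>UNIV. (borel :: real measure))"
    by (simp only: sets_PiM_equal_borel)
  have K_eq: "K = (\<lambda>y. override_below n y (\<lambda>_. 0)) -` (r -` K) \<inter> space (gauss_measure n)"
  proof -
    have "r (override_below n y (\<lambda>_. 0)) = y" if "y \<in> Rn n" for y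
      using that by (auto simp: r_def override_below_def Rn_def PiE_def extensional_def)
    then show ?thesis using sub by (auto simp: space_gauss_measure)
  qed
  show ?thesis
    using measurable_sets[OF measurable_override_below closed, of n "\<lambda>_. 0"]
    unfolding K_eq[symmetric] by (simp add: sets_gauss_measure)
qed

section \<open>Sections of a convex body\<close>

lemma frame_map_cong: "(\<And>j. j < n \<Longrightarrow> x j = y j) \<Longrightarrow> frame_map n U x = frame_map n U y"
  by (simp add: frame_map_def)

lemma log_concave_seq_frame_map:
  assumes K: "convex_body n K"
  shows "log_concave_seq (\<lambda>z. indicator K (frame_map n U z))"
  unfolding log_concave_seq_def
proof (intro conjI allI impI)
  fix x y :: "nat \<Rightarrow> real" and t :: real
  assume t: "0 < t" "t < 1"
  show "indicator K (frame_map n U x) powr (1 - t) * indicator K (frame_map n U y) powr t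
      \<le> (indicator K (frame_map n U (\<lambda>i. (1 - t) * x i + t * y i)) :: real)"
  proof (cases "frame_map n U x \<in> K \<and> frame_map n U y \<in> K")
    case True
    then have "(\<lambda>i\<in>{..<n}. (1 - t) * frame_map n U x i + t * frame_map n U y i) \<in> K"
      using K t by (auto simp: convex_body_def)
    also have "(\<lambda>i\<in>{..<n}. (1 - t) * frame_map n U x i + t * frame_map n U y i)
        = frame_map n U (\<lambda>i. (1 - t) * x i + t * y i)"
      by (auto simp: frame_map_def sum_distrib_left sum.distrib distrib_right mult.assoc)
    finally show ?thesis by (simp add: indicator_def)
  qed (auto simp: indicator_def)
qed simp

lemma measurable_seq_frame_map:
  assumes K: "K \<in> sets (Rn_lebesgue n)"
  shows "(\<lambda>z. indicator K (frame_map n U z) :: real) \<in> borel_measurable (\<Pi>\<^sub>M i\<in>UNIV. borel)"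
proof -
  have "frame_map n U \<in> (\<Pi>\<^sub>M i\<in>UNIV. borel) \<rightarrow>\<^sub>M Rn_lebesgue n"
    unfolding frame_map_def[abs_def]
    by (intro measurable_into_Rn borel_measurable_sum borel_measurable_times
      measurable_component_singleton) auto
  then show ?thesis by (rule measurable_compose) (use K in simp)
qed

lemma dot_commute: "dot n x y = dot n y x"
  by (simp add: dot_def mult.commute)

lemma abs_dot_le: "\<bar>dot n x y\<bar> \<le> L2_set x {..<n} * L2_set y {..<n}"
proof -
  have "\<bar>dot n x y\<bar> \<le> (\<Sum>i<n. \<bar>x i\<bar> * \<bar>y i\<bar>)"
    unfolding dot_def by (rule order_trans[OF sum_abs]) (simp add: abs_mult)
  also have "\<dots> \<le> L2_set x {..<n} * L2_set y {..<n}" by (rule L2_set_mult_ineq)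
  finally show ?thesis .
qed

locale sectioned_body =
  fixes m :: nat and K :: "(nat \<Rightarrow> real) set" and \<theta> :: "nat \<Rightarrow> real" and u :: "nat \<Rightarrow> nat \<Rightarrow> real"
  assumes K: "convex_body (Suc m) K"
    and \<theta>: "L2_set \<theta> {..<Suc m} = 1" and u: "hyperplane_basis (Suc m) \<theta> u"
begin

text \<open>\<theta> is placed last, at index m, so that integrating out the coordinates below m
  leaves the height along \<theta>.\<close>

definition U :: "nat \<Rightarrow> nat \<Rightarrow> real" where
  "U j = (if j < m then u j else \<theta>)"

definition F :: "(nat \<Rightarrow> real) \<Rightarrow> real" where
  "F z = indicator K (frame_map (Suc m) U z)"

text \<open>The base point 0 is arbitrary: coordinates below m are integrated out, and F ignores
  those above m.\<close>

definition section_gauss :: "real \<Rightarrow> real" where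
  "section_gauss v = marginals m F ((\<lambda>_. 0)(m := v))"

lemma frame: "orthonormal_frame (Suc m) U"
proof -
  have "(\<Sum>i<Suc m. (\<theta> i)\<^sup>2) = 1" using \<theta> by (simp add: L2_set_def)
  then have "dot (Suc m) \<theta> \<theta> = 1" by (simp add: dot_def power2_eq_square)
  moreover have "dot (Suc m) \<theta> (u j) = 0" "dot (Suc m) (u j) \<theta> = 0" if "j < m" for j
    using u that dot_commute[of "Suc m" "u j" \<theta>] by (simp_all add: hyperplane_basis_def)
  moreover have "dot (Suc m) (u j) (u k) = (if j = k then 1 else 0)" if "j < m" "k < m" for j k
    using u that by (simp add: hyperplane_basis_def)
  ultimately show ?thesis unfolding orthonormal_frame_def U_def by (simp add: less_Suc_eq)
qed

lemma K_measurable [measurable]: "K \<in> sets (Rn_lebesgue (Suc m))"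
  using K by (intro closedin_Rn_measurable) (simp add: convex_body_def)

lemma K_subset: "K \<subseteq> Rn (Suc m)"
  using K closedin_subset[of "Rn_topology (Suc m)" K] by (simp add: convex_body_def topspace_Rn_topology)

lemma F_measurable: "F \<in> borel_measurable (\<Pi>\<^sub>M i\<in>UNIV. borel)"
  unfolding F_def[abs_def] by (rule measurable_seq_frame_map[OF K_measurable])

lemma F_bounds: "0 \<le> F z" "F z \<le> 1"
  by (simp_all add: F_def)

lemma F_cong: "(\<And>j. j < Suc m \<Longrightarrow> x j = y j) \<Longrightarrow> F x = F y"
  unfolding F_def by (simp add: frame_map_cong[of "Suc m" x y])

lemma section_gauss_measurable: "section_gauss \<in> borel_measurable borel"
proof -
  have "marginals m F \<in> borel_measurable (\<Pi>\<^sub>M i\<in>UNIV. borel)"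
    using marginals_properties[OF F_measurable F_bounds] by blast
  from measurable_compose[OF measurable_fun_upd_seq(1) this] show ?thesis
    unfolding section_gauss_def[abs_def] .
qed

lemma section_gauss_bounds: "0 \<le> section_gauss v" "section_gauss v \<le> 1"
  unfolding section_gauss_def using marginals_properties[OF F_measurable F_bounds] by auto

lemma log_concave_section_gauss: "log_concave section_gauss"
proof -
  have "log_concave_seq F" unfolding F_def[abs_def] by (rule log_concave_seq_frame_map[OF K])
  from log_concave_marginals[OF F_measurable F_bounds(2) this]
  show ?thesis unfolding section_gauss_def[abs_def] by (rule log_concave_seq_coordinate)
qed

lemma section_gauss_eq: "section_gauss v = (\<integral>y. F (y(m := v)) \<partial>gauss_measure m)"
proof -
  have "F (override_below m y ((\<lambda>_. 0)(m := v))) = F (y(m := v))" for y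
    by (rule F_cong) (auto simp: override_below_def)
  then show ?thesis
    unfolding section_gauss_def by (simp add: marginals_eq_integral[OF F_measurable F_bounds])
qed

lemma F_measurable_Rn [measurable]: "F \<in> borel_measurable (gauss_measure (Suc m))"
proof -
  have "(\<lambda>z. indicator K (frame_map (Suc m) U z) :: real) \<in> borel_measurable (Rn_lebesgue (Suc m))"
    by measurable
  then show ?thesis by (simp cong: measurable_cong_sets add: F_def[abs_def] sets_gauss_measure)
qed

lemma integral_section_gauss: "(\<integral>v. section_gauss v \<partial>std_normal) = gauss (Suc m) K"
proof -
  interpret prob_space "gauss_measure (Suc m)" by (rule prob_space_gauss_measure)
  have "(\<integral>v. section_gauss v \<partial>std_normal) = (\<integral>x. F x \<partial>gauss_measure (Suc m))"
    unfolding section_gauss_eq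
    by (rule integral_gauss_measure_Suc[symmetric], rule integrable_const_bound[where B=1])
       (use F_bounds in auto)
  also have "\<dots> = (\<integral>x. indicator K x \<partial>gauss_measure (Suc m))"
    unfolding F_def by (rule integral_frame_map[OF frame]) measurable
  also have "\<dots> = gauss (Suc m) K" by (rule gauss_eq_integral[symmetric]) measurable
  finally show ?thesis .
qed

lemma integral_id_section_gauss:
  assumes "gauss (Suc m) K \<noteq> 0"
  shows "(\<integral>v. v * section_gauss v \<partial>std_normal)
    = gauss (Suc m) K * dot (Suc m) (barycenter (Suc m) K) \<theta>"
proof -
  let ?n = "Suc m" and ?G = "gauss_measure (Suc m)"
  interpret G: prob_space ?G by (rule prob_space_gauss_measure)
  have int: "integrable ?G (\<lambda>x. g x * x i)"
    if "i < ?n" "g \<in> borel_measurable ?G" "\<And>x. \<bar>g x\<bar> \<le> 1" for g :: "(nat \<Rightarrow> real) \<Rightarrow> real" and i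
    by (rule Bochner_Integration.integrable_bound[OF integrable_gauss_measure_component[OF that(1)]])
       (use that in \<open>auto simp: abs_mult intro!: mult_left_le_one_le borel_measurable_times
          borel_measurable_integrable[OF integrable_gauss_measure_component]\<close>)
  have K_meas: "(\<lambda>x. indicator K x :: real) \<in> borel_measurable ?G"
    by (intro borel_measurable_indicator) (simp add: sets_gauss_measure)
  have "gauss ?n K * dot ?n (barycenter ?n K) \<theta>
      = (\<Sum>i<?n. (\<integral>x. indicator K x * x i \<partial>?G) * \<theta> i)"
    unfolding dot_def sum_distrib_left
  proof (intro sum.cong refl)
    fix i assume "i \<in> {..<?n}"
    \<comment> \<open>The factor \<open>gauss ?n K\<close> cancels the normalisation of the
      barycenter, since it is nonzero.\<close>
    then show "gauss ?n K * (barycenter ?n K i * \<theta> i) = (\<integral>x. indicator K x * x i \<partial>?G) * \<theta> i"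
      using assms by (simp only: barycenter_def restrict_apply if_True
        set_integral_gauss[OF measurable_Rn_component K_measurable] lessThan_iff) simp
  qed
  also have "\<dots> = (\<integral>x. (\<Sum>i<?n. indicator K x * x i * \<theta> i) \<partial>?G)"
    using int[OF _ K_meas] by (subst Bochner_Integration.integral_sum) auto
  also have "\<dots> = (\<integral>x. indicator K x * dot ?n x \<theta> \<partial>?G)"
    by (simp only: dot_def sum_distrib_left mult.assoc)
  also have "\<dots> = (\<integral>x. indicator K (frame_map ?n U x) * dot ?n (frame_map ?n U x) \<theta> \<partial>?G)"
    unfolding dot_def by (rule integral_frame_map[OF frame, symmetric]) measurable
  \<comment> \<open>In frame coordinates the inner product with \<theta> = \<open>U m\<close> is the
    coordinate of index m.\<close>
  also have "\<dots> = (\<integral>x. F x * x m \<partial>?G)"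
    using frame_map_dot[OF frame, of m] by (simp add: F_def U_def)
  also have "\<dots> = (\<integral>v. (\<integral>y. F (y(m := v)) * v \<partial>gauss_measure m) \<partial>std_normal)"
    using integral_gauss_measure_Suc[OF int[of m F]] F_bounds F_measurable_Rn by simp
  also have "\<dots> = (\<integral>v. v * section_gauss v \<partial>std_normal)"
    by (simp add: section_gauss_eq mult.commute)
  finally show ?thesis by simp
qed

text \<open>A combination of the u j is orthogonal to \<theta>, so the hyperplane condition holds by
  itself; undoing the shift by v \<theta> makes v the last frame coordinate.\<close>

lemma mem_hyperplane_section_iff:
  assumes y: "y \<in> Rn m"
  shows "(\<lambda>i\<in>{..<Suc m}. \<Sum>j<m. y j * u j i) \<in> hyperplane_section (Suc m) K \<theta> v
    \<longleftrightarrow> frame_map (Suc m) U (y(m := v)) \<in> K"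
proof -
  let ?n = "Suc m"
  define p where "p = (\<lambda>i\<in>{..<?n}. \<Sum>j<m. y j * u j i)"
  define q where "q = frame_map ?n U (y(m := v))"
  have q: "q i = p i + v * \<theta> i" if "i < ?n" for i
    using that by (simp add: q_def p_def frame_map_def U_def)
  have p_Rn: "p \<in> Rn ?n" and q_Rn: "q \<in> Rn ?n" by (auto simp: p_def q_def frame_map_def Rn_def)
  have p0: "p = frame_map ?n U (y(m := 0))" by (auto simp: p_def frame_map_def U_def)
  have "dot ?n \<theta> p = 0"
    using frame_map_dot[OF frame, of m "y(m := 0)"] by (simp add: p0 U_def dot_commute)
  then have "p \<in> hyperplane_section ?n K \<theta> v \<longleftrightarrow> (\<exists>x\<in>K. p = (\<lambda>i\<in>{..<?n}. x i - v * \<theta> i))"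
    using p_Rn by (auto simp: hyperplane_section_def)
  also have "\<dots> \<longleftrightarrow> q \<in> K"
  proof
    assume "\<exists>x\<in>K. p = (\<lambda>i\<in>{..<?n}. x i - v * \<theta> i)"
    then obtain x where x: "x \<in> K" "p = (\<lambda>i\<in>{..<?n}. x i - v * \<theta> i)" by blast
    then have x_Rn: "x \<in> Rn ?n" using K_subset by auto
    have "x = q"
      using x_Rn q_Rn unfolding Rn_def by (rule PiE_ext) (simp add: q x(2))
    with x(1) show "q \<in> K" by (simp only:)
  next
    assume "q \<in> K"
    moreover have "p = (\<lambda>i\<in>{..<?n}. q i - v * \<theta> i)"
      unfolding p_def by (rule restrict_ext) (simp add: q p_def)
    ultimately show "\<exists>x\<in>K. p = (\<lambda>i\<in>{..<?n}. x i - v * \<theta> i)" by blast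
  qed
  finally show ?thesis by (simp add: p_def q_def)
qed

lemma hyperplane_gauss_eq: "hyperplane_gauss (Suc m) u (hyperplane_section (Suc m) K \<theta> v) = section_gauss v"
proof -
  define A where "A = {y \<in> Rn m. (\<lambda>i\<in>{..<Suc m}. \<Sum>j<m. y j * u j i) \<in> hyperplane_section (Suc m) K \<theta> v}"
  have A: "A = {y \<in> Rn m. frame_map (Suc m) U (y(m := v)) \<in> K}"
    unfolding A_def using mem_hyperplane_section_iff by blast
  have "(\<lambda>y. frame_map (Suc m) U (y(m := v))) \<in> Rn_lebesgue m \<rightarrow>\<^sub>M Rn_lebesgue (Suc m)"
    unfolding frame_map_def
    by (intro measurable_into_Rn borel_measurable_sum borel_measurable_times)
       (auto simp: less_Suc_eq intro!: measurable_Rn_component)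
  from measurable_sets[OF this K_measurable] have A_meas: "A \<in> sets (Rn_lebesgue m)"
    by (simp add: A vimage_def space_Rn_lebesgue Int_def conj_commute)
  have "hyperplane_gauss (Suc m) u (hyperplane_section (Suc m) K \<theta> v) = gauss m A"
    by (simp add: hyperplane_gauss_def A_def)
  also have "\<dots> = (\<integral>y. indicator A y \<partial>gauss_measure m)" by (rule gauss_eq_integral[OF A_meas])
  also have "\<dots> = (\<integral>y. F (y(m := v)) \<partial>gauss_measure m)"
    by (rule Bochner_Integration.integral_cong) (auto simp: A F_def space_gauss_measure indicator_def)
  also have "\<dots> = section_gauss v" by (simp add: section_gauss_eq)
  finally show ?thesis .
qed

lemma hyperplane_section_lower_bound:
  assumes \<alpha>: "gauss (Suc m) K = \<alpha>" "3 / 5 \<le> \<alpha>"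
    and \<eta>: "L2_set (barycenter (Suc m) K) {..<Suc m} = \<eta>" "\<eta> \<le> 1 / 100000"
    and v: "\<bar>v\<bar> \<le> 1 / 10000"
  shows "(\<alpha> - \<eta>) * (1 - (if v = 0 then 0 else exp (- 1 / (100 * v\<^sup>2))) / (4 * sqrt (2 * pi)))
    \<le> hyperplane_gauss (Suc m) u (hyperplane_section (Suc m) K \<theta> v)"
proof -
  let ?b = "dot (Suc m) (barycenter (Suc m) K) \<theta>"
  interpret gaussian_weight section_gauss \<alpha> ?b
    by standard (use \<alpha> in \<open>auto simp: section_gauss_measurable section_gauss_bounds
      integral_section_gauss integral_id_section_gauss\<close>)
  \<comment> \<open>Cauchy-Schwarz with the unit vector \<theta>; this is the only way the norm of
    the barycenter enters.\<close>
  have "\<bar>?b\<bar> \<le> \<eta>" using abs_dot_le[of "Suc m" "barycenter (Suc m) K" \<theta>] by (simp add: \<eta> \<theta>)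
  from value_lower_bound[OF log_concave_section_gauss this \<eta>(2) v]
  show ?thesis by (simp only: hyperplane_gauss_eq)
qed

end

theorem theorem8p1:
  shows "\<exists>v\<^sub>0 \<eta>\<^sub>0 c\<^sub>0 :: real. v\<^sub>0 > 0 \<and> \<eta>\<^sub>0 > 0 \<and> c\<^sub>0 > 0 \<and>
    (\<forall>(n::nat) (K :: (nat \<Rightarrow> real) set) \<eta> \<alpha> v \<theta> u.
       n \<ge> 1 \<and> convex_body n K \<and>
       L2_set (barycenter n K) {..<n} = \<eta> \<and> \<eta> \<le> \<eta>\<^sub>0 \<and>
       gauss n K = \<alpha> \<and> \<alpha> \<ge> 3 / 5 \<and>
       v \<in> {-v\<^sub>0..v\<^sub>0} \<and>
       \<theta> \<in> Rn n \<and> L2_set \<theta> {..<n} = 1 \<and> hyperplane_basis n \<theta> u \<longrightarrow>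
       hyperplane_gauss n u (hyperplane_section n K \<theta> v) \<ge>
         (\<alpha> - c\<^sub>0 * \<eta>) *
         (1 - (if v = 0 then 0 else exp (- 1 / (100 * v\<^sup>2))) / (4 * sqrt (2 * pi))))"
\<comment> \<open>The sum v_0 + \<eta>_0 = 11/100000 bounds v - m and is below 1/8000, the threshold
  set by the steep slopes.\<close>
proof (rule exI[of _ "1 / 10000"], rule exI[of _ "1 / 100000"], rule exI[of _ 1],
    intro conjI allI impI)
  fix n :: nat and K :: "(nat \<Rightarrow> real) set" and \<eta> \<alpha> v :: real and \<theta> u
  assume *: "n \<ge> 1 \<and> convex_body n K \<and>
       L2_set (barycenter n K) {..<n} = \<eta> \<and> \<eta> \<le> 1 / 100000 \<and>
       gauss n K = \<alpha> \<and> \<alpha> \<ge> 3 / 5 \<and>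
       v \<in> {- (1 / 10000)..1 / 10000} \<and>
       \<theta> \<in> Rn n \<and> L2_set \<theta> {..<n} = 1 \<and> hyperplane_basis n \<theta> u"
  then obtain m where n: "n = Suc m" by (cases n) auto
  interpret sectioned_body m K \<theta> u by standard (use * n in auto)
  have "- (1 / 10000) \<le> v" "v \<le> 1 / 10000" using * by auto
  then have "\<bar>v\<bar> \<le> 1 / 10000" by linarith
  then show "hyperplane_gauss n u (hyperplane_section n K \<theta> v) \<ge>
         (\<alpha> - 1 * \<eta>) *
         (1 - (if v = 0 then 0 else exp (- 1 / (100 * v\<^sup>2))) / (4 * sqrt (2 * pi)))"
    using hyperplane_section_lower_bound[of \<alpha> \<eta> v] * unfolding n by simp
qed simp_all

end
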